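(* The sequence of iterates $\{\mathbf{x}^r\}_{r\ge 0}$ generated by the cyclic coordinatewise descent algorithm for $f_1$ converges to some $\mathbf{x}^*\in\mathcal{X}$ such that $f_1(\mathbf{x}^* )\le f_1(\mathbf{x})$ for every $\mathbf{x}\in\mathcal{X}$.
   Context: Setting. Let $m,n\ge 1$ be integers, $S\subseteq\{1,\dots,n\}$ with complement $S^c=\{1,\dots,n\}\setminus S$, $\lambda>0$, and $E$ a real $m\times n$ matrix with no zero column. Let $g:\mathbb{R}^m\to\mathbb{R}\cup\{\infty\}$ be a convex function, and let $C_g$ be the interior of its effective domain $\{\mathbf{t}: g(\mathbf{t})<\infty\}$. Put $\mathcal{X}=\{\mathbf{x}\in\mathbb{R}^n: x_i\ge 0 \text{ for every } i\in S^c\}$ and $f_1(\mathbf{x})=g(E\mathbf{x})+\lambda\sum_{i\in S}|x_i|$ (possibly $+\infty$). Assumptions. (A1) $C_g\neq\emptyset$. (A2) $g$ is strictly convex and twice continuously differentiable on $C_g$. (A3) Either $g(\mathbf{t})\to\infty$ as $\mathbf{t}$ approaches the boundary of $C_g$; or $|S|=n$ and $g$ is non-negative with $C_g=\mathbb{R}^m$. (A4) $g$ has positive curvature everywhere on $C_g$, i.e. $\nabla^2 g(\mathbf{t})$ is positive definite for all $\mathbf{t}\in C_g$. (A5) The set $\mathcal{X}^*$ of minimizers of $f_1$ over $\mathcal{X}$ is non-empty. Cyclic coordinatewise descent algorithm for $f_1$. Start with $\mathbf{x}^0\in\mathcal{X}$ such that $f_1(\mathbf{x}^0)$ is finite. For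 $r=0,1,2,\dots$: set $\mathbf{x}^{r,0}=\mathbf{x}^r$; for $i=1,2,\dots,n$ let $\mathbf{x}^{r,i}$ be the minimizer of $f_1(\mathbf{x})$ over all $\mathbf{x}\in\mathcal{X}$ with $x_j=x^{r,i-1}_j$ for all $j\ne i$ (this minimizer exists and is unique under the assumptions); set $\mathbf{x}^{r+1}=\mathbf{x}^{r,n}$. The algorithm is run indefinitely, giving an infinite sequence $\{\mathbf{x}^r\}_{r\ge0}$. *)

theory Defs
  imports "HOL-Analysis.Analysis"
begin

section \<open>Convexity, gradient and Hessian\<close>

text \<open>Functions with values in \<open>\<real> \<union> {\<infinity>}\<close> are rendered as \<^typ>\<open>ereal\<close>-valued functions
  that avoid \<open>-\<infinity>\<close>; for those no undefined sum \<open>\<infinity> - \<infinity>\<close> occurs below.\<close>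

definition ext_convex :: "('a::real_vector \<Rightarrow> ereal) \<Rightarrow> bool" where
  "ext_convex g \<longleftrightarrow>
     (\<forall>s t u. 0 < u \<and> u < 1 \<longrightarrow>
        g ((1 - u) *\<^sub>R s + u *\<^sub>R t) \<le> ereal (1 - u) * g s + ereal u * g t)"

definition strictly_convex_on :: "'a::real_vector set \<Rightarrow> ('a \<Rightarrow> real) \<Rightarrow> bool" where
  "strictly_convex_on C h \<longleftrightarrow> convex C \<and>
     (\<forall>s\<in>C. \<forall>t\<in>C. \<forall>u. s \<noteq> t \<and> 0 < u \<and> u < 1 \<longrightarrow>
        h ((1 - u) *\<^sub>R s + u *\<^sub>R t) < (1 - u) * h s + u * h t)"

definition gradient :: "(real ^ 'm \<Rightarrow> real) \<Rightarrow> real ^ 'm \<Rightarrow> real ^ 'm" where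
  "gradient h t = (THE D. GDERIV h t :> D)"

definition hessian :: "(real ^ 'm \<Rightarrow> real) \<Rightarrow> real ^ 'm \<Rightarrow> real ^ 'm ^ 'm" where
  "hessian h t = matrix (frechet_derivative (gradient h) (at t))"

text \<open>Intended for open \<open>C\<close>.\<close>

definition twice_cont_diff_on :: "(real ^ 'm) set \<Rightarrow> (real ^ 'm \<Rightarrow> real) \<Rightarrow> bool" where
  "twice_cont_diff_on C h \<longleftrightarrow>
     (\<forall>t\<in>C. h differentiable (at t)) \<and>
     (\<forall>t\<in>C. gradient h differentiable (at t)) \<and>
     continuous_on C (hessian h)"

text \<open>Symmetry is not required; Hessians of twice continuously differentiable functions on open
  sets are symmetric anyway.\<close>

definition positive_definite :: "real ^ 'm ^ 'm \<Rightarrow> bool" where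
  "positive_definite A \<longleftrightarrow> (\<forall>v. v \<noteq> 0 \<longrightarrow> 0 < v \<bullet> (A *v v))"

section \<open>The optimization problem\<close>

definition dom_interior :: "('a::topological_space \<Rightarrow> ereal) \<Rightarrow> 'a set" where
  "dom_interior g = interior {t. g t < \<infinity>}"

text \<open>The coordinates outside \<open>S\<close> are constrained to be nonnegative, those in \<open>S\<close> are free
  and penalized.\<close>

definition feasible :: "'n set \<Rightarrow> (real ^ 'n) set" where
  "feasible S = {x. \<forall>i\<in>- S. 0 \<le> x $ i}"

definition f1 ::
  "(real ^ 'm \<Rightarrow> ereal) \<Rightarrow> real ^ 'n ^ 'm \<Rightarrow> 'n set \<Rightarrow> real \<Rightarrow> real ^ 'n \<Rightarrow> ereal" where
  "f1 g E S lam x = g (E *v x) + ereal (lam * (\<Sum>i\<in>S. \<bar>x $ i\<bar>))"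

definition minimizers :: "('a \<Rightarrow> ereal) \<Rightarrow> 'a set \<Rightarrow> 'a set" where
  "minimizers f X = {x \<in> X. \<forall>z\<in>X. f x \<le> f z}"

section \<open>Cyclic coordinatewise descent\<close>

text \<open>The index type \<open>'n\<close> carries no order, so \<open>\<sigma>\<close> enumerates it: \<open>\<sigma> i\<close> is the \<open>i\<close>-th
  coordinate for \<open>i = 1, \<dots>, n\<close>. The \<open>y i\<close> are the intermediate iterates of one sweep.\<close>

definition ccd_sweep ::
  "(real ^ 'n \<Rightarrow> ereal) \<Rightarrow> (real ^ 'n) set \<Rightarrow> (nat \<Rightarrow> 'n) \<Rightarrow> real ^ 'n \<Rightarrow> real ^ 'n \<Rightarrow> bool" where
  "ccd_sweep f X \<sigma> x x' \<longleftrightarrow>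
     (\<exists>y :: nat \<Rightarrow> real ^ 'n.
        y 0 = x \<and>
        (\<forall>i\<in>{1..CARD('n)}.
           y i \<in> minimizers f {z \<in> X. \<forall>j. j \<noteq> \<sigma> i \<longrightarrow> z $ j = y (i - 1) $ j}) \<and>
        x' = y CARD('n))"

definition ccd_iterates ::
  "(real ^ 'n \<Rightarrow> ereal) \<Rightarrow> (real ^ 'n) set \<Rightarrow> (nat \<Rightarrow> 'n) \<Rightarrow> (nat \<Rightarrow> real ^ 'n) \<Rightarrow> bool" where
  "ccd_iterates f X \<sigma> x \<longleftrightarrow>
     x 0 \<in> X \<and> \<bar>f (x 0)\<bar> \<noteq> \<infinity> \<and> (\<forall>r. ccd_sweep f X \<sigma> (x r) (x (Suc r)))"

end

theory Submission
  imports Defs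
begin

text \<open>Near a minimizer the problem looks like the minimization of a smooth strongly convex
  function of \<open>E *v x\<close> over a polyhedral cone, and there the method converges linearly. The
  difficulty is that \<open>E\<close> may have a kernel: the minimizers can form an unbounded set, and neither
  boundedness of the iterates nor strong convexity in \<open>x\<close> is available. Everything is therefore
  measured in the images \<open>t = E *v x\<close>, in which the optimal point \<open>ts\<close> is unique.

  Let \<open>h\<close> be the real-valued restriction of \<open>g\<close> to \<open>dom_interior g\<close>, and let \<open>p\<close> be its gradient
  at \<open>ts\<close>. Optimality at a minimizer says that the penalty terms dominate the linear function
  \<open>- p \<bullet> (E *v x)\<close>, so the objective dominates the tilted function \<open>h t - p \<bullet> t\<close>, which is
  minimal at \<open>ts\<close>. All images thus lie in one sublevel set of the tilted function. It is compact
  (\<open>compact_tilted_sublevel\<close>), and on it \<open>h\<close> is strongly convex with Lipschitz gradient.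

  Strong convexity along the columns of \<open>E\<close>, which do not vanish, makes a sweep from \<open>x\<close> to \<open>x'\<close>
  decrease the objective by a multiple of \<open>(norm (x' - x))\<^sup>2\<close>, and each coordinate of \<open>x'\<close> is
  optimal up to an error \<open>O(norm (x' - x))\<close> in its slope (\<open>sweep_estimates\<close>). The steps tend to
  \<open>0\<close>, so a limit point of the images satisfies the optimality conditions, and the images
  converge to \<open>ts\<close> (\<open>images_tendsto\<close>). The slopes then converge as well, and after finitely many
  sweeps every coordinate is complementary to its limiting slope (\<open>identification\<close>).

  From then on Hoffman's error bound (\<open>conformal_error_bound\<close>) supplies a minimizer at distance
  \<open>O(norm (E *v x' - ts))\<close> from \<open>x'\<close>. Comparison with this minimizer and the quadratic growth of
  the objective in \<open>E *v x' - ts\<close> bound the gap in the objective at \<open>x'\<close> by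
  \<open>O((norm (x' - x))\<^sup>2)\<close> (\<open>linear_rate\<close>), hence by a multiple of the decrease in the sweep. So the
  gap decays geometrically, the lengths of the sweeps are summable, and the iterates form a
  Cauchy sequence whose limit has image \<open>ts\<close> and the optimal value.\<close>

section \<open>Second-order estimates on compact convex sets\<close>

lemma GDERIV_gradient:
  fixes h :: "real ^ 'm \<Rightarrow> real"
  assumes "h differentiable (at t)"
  shows "GDERIV h t :> gradient h t"
proof -
  obtain D where D: "(h has_derivative D) (at t)"
    using assms by (auto simp: differentiable_def)
  then have "linear D"
    by (rule has_derivative_linear)
  then have "D = (\<lambda>v. v \<bullet> adjoint D 1)"
    using adjoint_works[of D] by (auto simp: fun_eq_iff)
  then have ex: "GDERIV h t :> adjoint D 1"
    unfolding gderiv_def using D by metis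
  have "\<exists>!d. GDERIV h t :> d"
  proof (rule ex_ex1I)
    show "\<exists>d. GDERIV h t :> d" using ex by blast
    fix a b assume "GDERIV h t :> a" "GDERIV h t :> b"
    then have "(\<lambda>v. v \<bullet> a) = (\<lambda>v. v \<bullet> b)"
      unfolding gderiv_def by (rule has_derivative_unique)
    then have "\<forall>v. v \<bullet> a = v \<bullet> b" by metis
    then show "a = b" by (rule vector_eq_ldot[THEN iffD1])
  qed
  then show ?thesis
    unfolding gradient_def by (rule theI')
qed

lemma has_derivative_gradient:
  fixes h :: "real ^ 'm \<Rightarrow> real"
  assumes "gradient h differentiable (at t)"
  shows "(gradient h has_derivative (\<lambda>v. hessian h t *v v)) (at t)"
proof -
  have *: "(gradient h has_derivative frechet_derivative (gradient h) (at t)) (at t)"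
    using assms by (simp add: frechet_derivative_works)
  have "linear (frechet_derivative (gradient h) (at t))"
    using * by (rule has_derivative_linear)
  then have "frechet_derivative (gradient h) (at t) = (\<lambda>v. hessian h t *v v)"
    unfolding hessian_def by (simp add: matrix_works fun_eq_iff)
  with * show ?thesis by simp
qed

lemma continuous_on_matrix_vector_mult:
  fixes A :: "'a::topological_space \<Rightarrow> real ^ 'n ^ 'm" and v :: "'a \<Rightarrow> real ^ 'n"
  assumes "continuous_on S A" "continuous_on S v"
  shows "continuous_on S (\<lambda>x. A x *v v x)"
  unfolding matrix_vector_mult_def using assms
  by (intro continuous_intros)

text \<open>On a compact set the Hessian is positive definite with a uniform constant, because it is
  continuous on the product of that set with the unit sphere; Taylor's formula along segments
  then gives strong convexity, although it may fail on all of \<open>C\<close>.\<close>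

lemma strong_convexity_on_compact:
  fixes h :: "real ^ 'm \<Rightarrow> real"
  assumes C2: "twice_cont_diff_on C h"
    and pd: "\<forall>t\<in>C. positive_definite (hessian h t)"
    and K: "K \<subseteq> C" "compact K" "convex K"
  shows "\<exists>c>0. \<forall>s\<in>K. \<forall>t\<in>K. h t + gradient h t \<bullet> (s - t) + c * (norm (s - t))\<^sup>2 \<le> h s"
proof -
  let ?P = "K \<times> sphere (0::real^'m) 1"
  let ?q = "\<lambda>p. snd p \<bullet> (hessian h (fst p) *v snd p)"
  have "continuous_on K (hessian h)"
    using C2 K(1) unfolding twice_cont_diff_on_def by (blast intro: continuous_on_subset)
  then have "continuous_on ?P (\<lambda>p. hessian h (fst p))"
    by (rule continuous_on_compose2) (auto intro: continuous_intros)
  then have cont: "continuous_on ?P ?q"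
    by (intro continuous_intros continuous_on_matrix_vector_mult)
  have "\<exists>c>0. \<forall>p\<in>?P. c \<le> ?q p"
  proof (cases "?P = {}")
    case True
    then show ?thesis by (auto intro: exI[of _ 1])
  next
    case False
    have "compact ?P" using K(2) by (intro compact_Times) auto
    then obtain p where p: "p \<in> ?P" "\<forall>p'\<in>?P. ?q p \<le> ?q p'"
      using continuous_attains_inf[OF _ False cont] by blast
    from p(1) obtain t v where tv: "p = (t, v)" "t \<in> K" "norm v = 1" by auto
    then have "v \<noteq> 0" by auto
    then have "0 < ?q p"
      using pd tv K(1) unfolding positive_definite_def by auto
    with p(2) show ?thesis by blast
  qed
  then obtain c where c: "c > 0" and unit: "\<And>t v. t \<in> K \<Longrightarrow> norm v = 1 \<Longrightarrow> c \<le> v \<bullet> (hessian h t *v v)"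
    by force
  have curv: "c * (norm v)\<^sup>2 \<le> v \<bullet> (hessian h t *v v)" if "t \<in> K" for t v
  proof (cases "v = 0")
    case False
    let ?u = "(1 / norm v) *\<^sub>R v"
    have "norm ?u = 1" using False by simp
    from unit[OF that this] have "c \<le> ?u \<bullet> (hessian h t *v ?u)" .
    also have "\<dots> = (v \<bullet> (hessian h t *v v)) / (norm v)\<^sup>2"
      by (simp add: matrix_vector_mult_scaleR power2_eq_square)
    finally show ?thesis using False by (simp add: field_simps)
  qed auto
  have "h t + gradient h t \<bullet> (s - t) + c / 2 * (norm (s - t))\<^sup>2 \<le> h s" if st: "s \<in> K" "t \<in> K" for s t
  proof -
    define v where "v = s - t"
    have seg: "t + r *\<^sub>R v \<in> K" if "0 \<le> r" "r \<le> 1" for r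
    proof -
      have "t + r *\<^sub>R v = (1 - r) *\<^sub>R t + r *\<^sub>R s"
        by (simp add: v_def algebra_simps)
      then show ?thesis using convexD_alt[OF K(3) st(2,1)] that by simp
    qed
    define diff where "diff = (\<lambda>m::nat. if m = 0 then (\<lambda>r. h (t + r *\<^sub>R v))
      else if m = 1 then (\<lambda>r. v \<bullet> gradient h (t + r *\<^sub>R v))
      else (\<lambda>r. v \<bullet> (hessian h (t + r *\<^sub>R v) *v v)))"
    have line: "((\<lambda>r. t + r *\<^sub>R v) has_derivative (\<lambda>r. r *\<^sub>R v)) (at r)" for r :: real
      by (auto intro!: derivative_eq_intros)
    have d0: "DERIV (diff 0) r :> diff 1 r" if "0 \<le> r" "r \<le> 1" for r
    proof -
      have "h differentiable at (t + r *\<^sub>R v)"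
        using C2 seg[OF that] K(1) unfolding twice_cont_diff_on_def by blast
      then have "(h has_derivative (\<lambda>w. w \<bullet> gradient h (t + r *\<^sub>R v))) (at (t + r *\<^sub>R v))"
        using GDERIV_gradient unfolding gderiv_def by blast
      from has_derivative_compose[OF line this]
      show ?thesis
        by (simp add: has_field_derivative_def diff_def mult_commute_abs)
    qed
    have d1: "DERIV (diff 1) r :> diff 2 r" if "0 \<le> r" "r \<le> 1" for r
    proof -
      have "gradient h differentiable at (t + r *\<^sub>R v)"
        using C2 seg[OF that] K(1) unfolding twice_cont_diff_on_def by blast
      from has_derivative_compose[OF line has_derivative_gradient[OF this]]
      have "((\<lambda>r. v \<bullet> gradient h (t + r *\<^sub>R v)) has_derivative
        (\<lambda>x. v \<bullet> (hessian h (t + r *\<^sub>R v) *v (x *\<^sub>R v)))) (at r)"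
        by (rule has_derivative_inner_right)
      then show ?thesis
        by (simp add: has_field_derivative_def diff_def matrix_vector_mult_scaleR
            mult_commute_abs)
    qed
    have "\<forall>m r. m < 2 \<and> 0 \<le> r \<and> r \<le> 1 \<longrightarrow> DERIV (diff m) r :> diff (Suc m) r"
    proof (intro allI impI)
      fix m :: nat and r :: real assume "m < 2 \<and> 0 \<le> r \<and> r \<le> 1"
      then show "DERIV (diff m) r :> diff (Suc m) r"
        using d0[of r] d1[of r] by (cases m) (auto simp: numeral_2_eq_2 less_Suc_eq)
    qed
    then obtain r where r: "0 < r" "r < 1"
      "diff 0 1 = (\<Sum>m<2. (diff m 0 / fact m) * (1 - 0) ^ m) + (diff 2 r / fact 2) * (1 - 0) ^ 2"
      using Taylor_up[of 2 diff "diff 0" 0 1 0] by auto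
    have "diff 0 1 = h s" "diff 0 0 = h t" "diff 1 0 = gradient h t \<bullet> v"
      by (simp_all add: diff_def v_def inner_commute)
    moreover have "c * (norm v)\<^sup>2 \<le> diff 2 r"
      using curv[OF seg, of r v] r(1,2) by (simp add: diff_def)
    ultimately show ?thesis
      using r(3) by (simp add: numeral_2_eq_2 v_def)
  qed
  then show ?thesis using c by (intro exI[of _ "c / 2"]) auto
qed

lemma gradient_lipschitz_on_compact:
  fixes h :: "real ^ 'm \<Rightarrow> real"
  assumes C2: "twice_cont_diff_on C h"
    and K: "K \<subseteq> C" "compact K" "convex K"
  shows "\<exists>L\<ge>0. \<forall>s\<in>K. \<forall>t\<in>K. norm (gradient h s - gradient h t) \<le> L * norm (s - t)"
proof -
  let ?P = "K \<times> sphere (0::real^'m) 1"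
  let ?q = "\<lambda>p. hessian h (fst p) *v snd p"
  have "continuous_on K (hessian h)"
    using C2 K(1) unfolding twice_cont_diff_on_def by (blast intro: continuous_on_subset)
  then have "continuous_on ?P (\<lambda>p. hessian h (fst p))"
    by (rule continuous_on_compose2) (auto intro: continuous_intros)
  then have "continuous_on ?P ?q"
    by (intro continuous_intros continuous_on_matrix_vector_mult)
  moreover have "compact ?P" using K(2) by (intro compact_Times) auto
  ultimately have "bounded (?q ` ?P)"
    by (intro compact_imp_bounded compact_continuous_image)
  then obtain L where L: "L > 0" "\<And>t v. t \<in> K \<Longrightarrow> norm v = 1 \<Longrightarrow> norm (hessian h t *v v) \<le> L"
    by (force simp: bounded_pos)
  have "norm (gradient h s - gradient h t) \<le> L * norm (s - t)" if "s \<in> K" "t \<in> K" for s t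
  proof (rule differentiable_bound[OF K(3) _ _ that])
    fix x assume x: "x \<in> K"
    then have "gradient h differentiable at x"
      using C2 K(1) unfolding twice_cont_diff_on_def by blast
    from has_derivative_gradient[OF this]
    show "(gradient h has_derivative (\<lambda>v. hessian h x *v v)) (at x within K)"
      by (rule has_derivative_at_withinI)
    show "onorm (\<lambda>v. hessian h x *v v) \<le> L"
    proof (rule onorm_le)
      fix v
      show "norm (hessian h x *v v) \<le> L * norm v"
      proof (cases "v = 0")
        case False
        then have "norm (hessian h x *v ((1 / norm v) *\<^sub>R v)) \<le> L"
          by (intro L(2)[OF x]) simp
        then show ?thesis using False by (simp add: matrix_vector_mult_scaleR field_simps)
      qed auto
    qed
  qed
  then show ?thesis using L(1) by (intro exI[of _ L]) auto
qed

section \<open>Effective domain and compact sublevel sets\<close>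

text \<open>A point of the effective domain outside its interior is a boundary point, and by convexity
  the function is bounded on the segment from there to an interior point, against the blow-up
  at the boundary.\<close>

lemma finite_iff_mem_dom_interior:
  fixes g :: "'a::euclidean_space \<Rightarrow> ereal"
  assumes conv: "ext_convex g"
    and ne: "dom_interior g \<noteq> {}"
    and blowup: "\<forall>b\<in>frontier (dom_interior g). (g \<longlongrightarrow> \<infinity>) (at b within dom_interior g)"
  shows "g b < \<infinity> \<longleftrightarrow> b \<in> dom_interior g"
proof
  let ?D = "{t. g t < \<infinity>}"
  assume b: "g b < \<infinity>"
  have cvx: "g ((1 - u) *\<^sub>R s + u *\<^sub>R t) \<le> ereal (1 - u) * g s + ereal u * g t"
    if "0 < u" "u < 1" for s t u
    using conv that unfolding ext_convex_def by blast
  have "convex ?D"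
    unfolding convex_alt
  proof (intro ballI allI impI)
    fix s t :: 'a and u :: real assume st: "s \<in> ?D" "t \<in> ?D" and u: "0 \<le> u \<and> u \<le> 1"
    show "(1 - u) *\<^sub>R s + u *\<^sub>R t \<in> ?D"
    proof (cases "u = 0 \<or> u = 1")
      case False
      then have "ereal (1 - u) * g s + ereal u * g t < \<infinity>"
        using st u by (cases "g s"; cases "g t") auto
      with cvx[of u s t] False u show ?thesis by auto
    qed (use st in auto)
  qed
  show "b \<in> dom_interior g"
  proof (rule ccontr)
    assume nb: "b \<notin> dom_interior g"
    from ne obtain a where a: "a \<in> dom_interior g" by blast
    then have fa: "g a < \<infinity>" unfolding dom_interior_def using interior_subset by blast
    define l where "l u = (1 - u) *\<^sub>R a + u *\<^sub>R b" for u :: real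
    have "b \<in> closure ?D" using b closure_subset[of ?D] by auto
    then have seg: "open_segment a b \<subseteq> dom_interior g"
      using in_interior_closure_convex_segment[OF \<open>convex ?D\<close>] a unfolding dom_interior_def by simp
    have "a \<noteq> b" using a nb by auto
    then have l: "l u \<in> dom_interior g" "l u \<noteq> b" if "0 < u" "u < 1" for u
    proof -
      have "l u \<in> open_segment a b"
        unfolding in_segment l_def using that \<open>a \<noteq> b\<close> by (intro conjI exI[of _ u]) auto
      with seg show "l u \<in> dom_interior g" by (rule subsetD)
      with nb show "l u \<noteq> b" by auto
    qed
    define u where "u n = 1 - 1 / real (n + 2)" for n
    have u: "0 < u n" "u n < 1" for n by (auto simp: u_def)
    have "u \<longlonglongrightarrow> 1 - 0"
      unfolding u_def
      by (intro tendsto_diff tendsto_const LIMSEQ_ignore_initial_segment[OF lim_1_over_n])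
    then have "(\<lambda>n. l (u n)) \<longlonglongrightarrow> (1 - 1) *\<^sub>R a + 1 *\<^sub>R b"
      unfolding l_def by (intro tendsto_intros) simp_all
    then have lim: "(\<lambda>n. l (u n)) \<longlonglongrightarrow> b" by simp
    have "filterlim (\<lambda>n. l (u n)) (at b within dom_interior g) sequentially"
      unfolding filterlim_at using lim l u by (auto intro!: always_eventually)
    moreover have "b \<in> frontier (dom_interior g)"
    proof -
      have "b \<in> closure (dom_interior g)"
        unfolding closure_sequential
        using lim l(1)[OF u] by (intro exI[of _ "\<lambda>n. l (u n)"]) simp
      then show ?thesis using nb unfolding frontier_def dom_interior_def by simp
    qed
    ultimately have "(\<lambda>n. g (l (u n))) \<longlonglongrightarrow> \<infinity>"
      using blowup filterlim_compose by blast
    moreover obtain M where M: "g a \<le> ereal M" "g b \<le> ereal M" "0 \<le> M"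
    proof -
      have "\<exists>r. g a \<le> ereal r" using fa by (cases "g a") auto
      moreover have "\<exists>r. g b \<le> ereal r" using b by (cases "g b") auto
      ultimately obtain r s where "g a \<le> ereal r" "g b \<le> ereal s" by blast
      then have "g a \<le> ereal (\<bar>r\<bar> + \<bar>s\<bar>)" "g b \<le> ereal (\<bar>r\<bar> + \<bar>s\<bar>)"
        by (auto elim: order_trans)
      then show ?thesis using that by simp
    qed
    ultimately have "\<forall>\<^sub>F n in sequentially. ereal M < g (l (u n))"
      by (intro order_tendstoD) auto
    then obtain n where n: "ereal M < g (l (u n))"
      by (auto simp: eventually_sequentially)
    have "g (l (u n)) \<le> ereal (1 - u n) * g a + ereal (u n) * g b"
      unfolding l_def using cvx u[of n] by blast
    also have "\<dots> \<le> ereal (1 - u n) * ereal M + ereal (u n) * ereal M"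
      using M u[of n] by (intro add_mono ereal_mult_left_mono) auto
    also have "\<dots> = ereal M" by (simp add: algebra_simps)
    finally show False using n by simp
  qed
next
  assume "b \<in> dom_interior g"
  then show "g b < \<infinity>" unfolding dom_interior_def using interior_subset by blast
qed

text \<open>The linear term makes \<open>t0\<close> a critical point. Around it the tilted function grows
  quadratically, hence by convexity at least linearly further out, which bounds the sublevel set;
  the blow-up keeps its limit points inside \<open>C\<close>.\<close>

lemma compact_tilted_sublevel:
  fixes h :: "real ^ 'm \<Rightarrow> real"
  assumes "open C" and cvx: "strictly_convex_on C h"
    and C2: "twice_cont_diff_on C h"
    and pd: "\<forall>t\<in>C. positive_definite (hessian h t)"
    and blowup: "\<forall>b\<in>frontier C. filterlim h at_top (at b within C)"
    and t0: "t0 \<in> C"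
  shows "compact {t\<in>C. h t - gradient h t0 \<bullet> t \<le> c}"
proof -
  let ?p = "gradient h t0" and ?K = "{t\<in>C. h t - gradient h t0 \<bullet> t \<le> c}"
  obtain \<rho> where \<rho>: "\<rho> > 0" "cball t0 \<rho> \<subseteq> C"
    using \<open>open C\<close> t0 open_contains_cball by blast
  obtain \<mu> where \<mu>: "\<mu> > 0" "\<And>s t. s \<in> cball t0 \<rho> \<Longrightarrow> t \<in> cball t0 \<rho> \<Longrightarrow>
      h t + gradient h t \<bullet> (s - t) + \<mu> * (norm (s - t))\<^sup>2 \<le> h s"
    using strong_convexity_on_compact[OF C2 pd \<rho>(2)] by (auto simp: convex_cball)
  have far: "\<mu> * \<rho> * norm (t - t0) \<le> h t - h t0 - ?p \<bullet> (t - t0)"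
    if t: "t \<in> C" "\<rho> < norm (t - t0)" for t
  proof -
    let ?R = "norm (t - t0)"
    define u where "u = \<rho> / ?R"
    have "0 < ?R" using t(2) \<rho>(1) by (rule less_trans[rotated])
    then have u: "0 < u" "u < 1" using t(2) \<rho>(1) by (simp_all add: u_def)
    define s where "s = (1 - u) *\<^sub>R t0 + u *\<^sub>R t"
    have st: "s - t0 = u *\<^sub>R (t - t0)" by (simp add: s_def algebra_simps)
    then have ns: "norm (s - t0) = \<rho>" using u t(2) \<rho>(1) by (auto simp: u_def)
    have "t \<noteq> t0" using t(2) \<rho>(1) by auto
    then have "h s \<le> (1 - u) * h t0 + u * h t"
      using cvx t(1) t0 u unfolding strictly_convex_on_def s_def by (metis less_le)
    moreover have "h t0 + ?p \<bullet> (s - t0) + \<mu> * \<rho>\<^sup>2 \<le> h s"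
      using \<mu>(2)[of s t0] ns \<rho>(1) by (simp add: dist_norm norm_minus_commute)
    ultimately have "\<mu> * \<rho>\<^sup>2 \<le> u * (h t - h t0 - ?p \<bullet> (t - t0))"
      unfolding st by (simp add: algebra_simps)
    then have "\<mu> * \<rho>\<^sup>2 * ?R \<le> u * (h t - h t0 - ?p \<bullet> (t - t0)) * ?R"
      using \<open>0 < ?R\<close> by (simp add: mult_right_mono)
    also have "\<dots> = \<rho> * (h t - h t0 - ?p \<bullet> (t - t0))"
      using \<open>0 < ?R\<close> by (simp add: u_def)
    finally have "\<mu> * \<rho>\<^sup>2 * ?R \<le> \<rho> * (h t - h t0 - ?p \<bullet> (t - t0))" .
    then have "\<rho> * (\<mu> * \<rho> * ?R) \<le> \<rho> * (h t - h t0 - ?p \<bullet> (t - t0))"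
      by (simp add: power2_eq_square mult_ac)
    then show ?thesis using \<rho>(1) by simp
  qed
  have "bounded ?K"
  proof -
    define B where "B = max \<rho> ((c - h t0 + ?p \<bullet> t0) / (\<mu> * \<rho>))"
    have "norm (t - t0) \<le> B" if "t \<in> ?K" for t
    proof (cases "\<rho> < norm (t - t0)")
      case True
      with far[of t] that have "\<mu> * \<rho> * norm (t - t0) \<le> c - h t0 + ?p \<bullet> t0"
        by (auto simp: inner_diff_right)
      then show ?thesis using \<mu>(1) \<rho>(1) by (auto simp: B_def field_simps le_max_iff_disj)
    qed (auto simp: B_def)
    then have "?K \<subseteq> cball t0 B" by (auto simp: dist_norm norm_minus_commute)
    then show ?thesis using bounded_cball bounded_subset by blast
  qed
  moreover have "closed ?K"
    unfolding closed_sequential_limits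
  proof (intro allI impI)
    fix t l assume "(\<forall>n. t n \<in> ?K) \<and> t \<longlonglongrightarrow> l"
    then have tC: "\<And>n. t n \<in> C" and tc: "\<And>n. h (t n) - ?p \<bullet> t n \<le> c" and l: "t \<longlonglongrightarrow> l" by auto
    have lp: "(\<lambda>n. ?p \<bullet> t n) \<longlonglongrightarrow> ?p \<bullet> l" by (intro tendsto_intros l)
    have "l \<in> C"
    proof (rule ccontr)
      assume nl: "l \<notin> C"
      have "l \<in> closure C"
        unfolding closure_sequential using tC l by (intro exI[of _ t]) simp
      then have "l \<in> frontier C"
        using nl \<open>open C\<close> by (simp add: frontier_def interior_open)
      moreover have "filterlim t (at l within C) sequentially"
        unfolding filterlim_at using l tC nl by (auto intro!: always_eventually)
      ultimately have "filterlim (\<lambda>n. h (t n)) at_top sequentially"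
        using blowup filterlim_compose by blast
      then have "\<forall>\<^sub>F n in sequentially. c + ?p \<bullet> l + 1 \<le> h (t n)"
        by (simp add: filterlim_at_top)
      moreover have "\<forall>\<^sub>F n in sequentially. ?p \<bullet> t n < ?p \<bullet> l + 1"
        using lp by (intro order_tendstoD) auto
      ultimately have "\<forall>\<^sub>F n in sequentially. False"
      proof eventually_elim
        case (elim n)
        then show ?case using tc[of n] by linarith
      qed
      then show False by simp
    qed
    then have "isCont h l"
      using C2 unfolding twice_cont_diff_on_def
      using differentiable_imp_continuous_within by blast
    then have "(\<lambda>n. h (t n) - ?p \<bullet> t n) \<longlonglongrightarrow> h l - ?p \<bullet> l"
      by (intro tendsto_diff lp isCont_tendsto_compose[OF _ l])
    then have "h l - ?p \<bullet> l \<le> c"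
      using tc by (intro LIMSEQ_le_const2[of _ _ c]) auto
    with \<open>l \<in> C\<close> show "l \<in> ?K" by simp
  qed
  ultimately show ?thesis by (simp add: compact_eq_bounded_closed)
qed

lemma convex_tilted_sublevel:
  assumes "strictly_convex_on C h"
  shows "convex {t\<in>C. h t - p \<bullet> t \<le> c}"
  unfolding convex_alt
proof (intro ballI allI impI)
  fix s t and u :: real
  assume st: "s \<in> {t\<in>C. h t - p \<bullet> t \<le> c}" "t \<in> {t\<in>C. h t - p \<bullet> t \<le> c}" and u: "0 \<le> u \<and> u \<le> 1"
  show "(1 - u) *\<^sub>R s + u *\<^sub>R t \<in> {t\<in>C. h t - p \<bullet> t \<le> c}"
  proof (cases "u = 0 \<or> u = 1 \<or> s = t")
    case True
    then show ?thesis using st by (auto simp: algebra_simps)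
  next
    case False
    let ?z = "(1 - u) *\<^sub>R s + u *\<^sub>R t"
    have "?z \<in> C"
      using assms st u unfolding strictly_convex_on_def convex_alt by blast
    have "h ?z \<le> (1 - u) * h s + u * h t"
      using assms st u False unfolding strictly_convex_on_def by (auto intro: less_imp_le)
    then have "h ?z - p \<bullet> ?z \<le> (1 - u) * (h s - p \<bullet> s) + u * (h t - p \<bullet> t)"
      by (simp add: inner_add_right algebra_simps)
    also have "\<dots> \<le> (1 - u) * c + u * c"
      using st u by (intro add_mono mult_left_mono) auto
    finally show ?thesis using \<open>?z \<in> C\<close> by (simp add: algebra_simps)
  qed
qed

section \<open>A conformal error bound for linear systems\<close>

text \<open>This is Hoffman's bound for sign-constrained linear systems. Among all vectors with the
  image of \<open>w\<close> that lie between \<open>0\<close> and \<open>w\<close> componentwise, one of least \<open>\<ell>\<^sub>1\<close>-norm admits no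
  nonzero kernel vector in the orthant face of its sign pattern, since subtracting a small
  multiple of it would shorten the vector. There are finitely many such faces, and on each that
  meets the kernel only in \<open>0\<close>, compactness of the unit sphere bounds \<open>norm v\<close> by a multiple of
  the norm of its image.\<close>

lemma conformal_error_bound:
  fixes E :: "real ^ 'n ^ 'm"
  shows "\<exists>k>0. \<forall>w. \<exists>v. E *v v = E *v w \<and> (\<forall>i. min 0 (w $ i) \<le> v $ i \<and> v $ i \<le> max 0 (w $ i))
           \<and> norm v \<le> k * norm (E *v w)"
proof -
  define orth where "orth p = {v::real^'n. (\<forall>i\<in>fst p. 0 \<le> v $ i) \<and> (\<forall>i\<in>snd p. v $ i \<le> 0) \<and>
    (\<forall>i. i \<notin> fst p \<union> snd p \<longrightarrow> v $ i = 0)}" for p :: "'n set \<times> 'n set"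
  define inj where "inj p \<longleftrightarrow> (\<forall>v\<in>orth p. E *v v = 0 \<longrightarrow> v = 0)" for p
  have cont: "continuous_on T (\<lambda>v. E *v v)" for T
    by (intro continuous_on_matrix_vector_mult continuous_intros)
  have orth_closed: "closed (orth p)" for p
  proof -
    have "orth p = (\<Inter>i\<in>fst p. {v. 0 \<le> v $ i}) \<inter> (\<Inter>i\<in>snd p. {v. v $ i \<le> 0})
      \<inter> (\<Inter>i\<in>- (fst p \<union> snd p). {v. v $ i = 0})"
      unfolding orth_def by auto
    then show ?thesis
      by (auto intro!: closed_Int closed_INT closed_Collect_le closed_Collect_eq continuous_intros)
  qed
  have orth_scale: "r *\<^sub>R v \<in> orth p" if "v \<in> orth p" "0 \<le> r" for r v p
    using that unfolding orth_def by (auto simp: mult_nonneg_nonpos)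
  have "\<exists>c>0. inj p \<longrightarrow> (\<forall>v\<in>orth p. norm v \<le> c * norm (E *v v))" for p
  proof (cases "inj p \<and> orth p \<inter> sphere 0 1 \<noteq> {}")
    case True
    have "compact (orth p \<inter> sphere 0 1)"
      using orth_closed by (intro closed_Int_compact) auto
    then obtain u where u: "u \<in> orth p \<inter> sphere 0 1"
      "\<forall>v\<in>orth p \<inter> sphere 0 1. norm (E *v u) \<le> norm (E *v v)"
      using continuous_attains_inf[of "orth p \<inter> sphere 0 1" "\<lambda>v. norm (E *v v)"] True
      by (blast intro: continuous_on_norm cont)
    have "u \<noteq> 0" using u(1) by auto
    then have pos: "0 < norm (E *v u)" using u(1) True unfolding inj_def by auto
    have "norm v \<le> 1 / norm (E *v u) * norm (E *v v)" if "v \<in> orth p" for v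
    proof (cases "v = 0")
      case False
      then have "(1 / norm v) *\<^sub>R v \<in> orth p \<inter> sphere 0 1"
        using orth_scale[OF that, of "1 / norm v"] by simp
      with u(2) have "norm (E *v u) \<le> norm (E *v ((1 / norm v) *\<^sub>R v))" by blast
      then show ?thesis using False pos by (simp add: matrix_vector_mult_scaleR field_simps)
    qed auto
    then show ?thesis using pos by (intro exI[of _ "1 / norm (E *v u)"]) auto
  next
    case False
    have "v = 0" if "inj p" "v \<in> orth p" for v
    proof (rule ccontr)
      assume "v \<noteq> 0"
      then have "(1 / norm v) *\<^sub>R v \<in> orth p \<inter> sphere 0 1"
        using orth_scale[OF that(2), of "1 / norm v"] by simp
      with False that(1) show False by blast
    qed
    then show ?thesis by (intro exI[of _ 1]) fastforce
  qed
  then obtain c where c: "\<And>p. 0 < c p" "\<And>p v. inj p \<Longrightarrow> v \<in> orth p \<Longrightarrow> norm v \<le> c p * norm (E *v v)"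
    by metis
  define k where "k = Max (range c)"
  have fin: "finite (range c)" by simp
  have ck: "c p \<le> k" for p unfolding k_def by (rule Max_ge[OF fin]) auto
  then have kpos: "0 < k" using c(1) by (meson less_le_trans)
  have "\<exists>v. E *v v = E *v w \<and> (\<forall>i. min 0 (w $ i) \<le> v $ i \<and> v $ i \<le> max 0 (w $ i))
           \<and> norm v \<le> k * norm (E *v w)" for w
  proof -
    define Q where "Q = {v. E *v v = E *v w} \<inter> cbox (\<chi> i. min 0 (w $ i)) (\<chi> i. max 0 (w $ i))"
    have Q: "v \<in> Q \<longleftrightarrow> E *v v = E *v w \<and> (\<forall>i. min 0 (w $ i) \<le> v $ i \<and> v $ i \<le> max 0 (w $ i))" for v
      by (auto simp: Q_def mem_box_cart)
    have "compact Q"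
      unfolding Q_def by (intro closed_Int_compact closed_Collect_eq cont continuous_intros) auto
    moreover have "w \<in> Q" by (auto simp: Q)
    moreover have "continuous_on Q (\<lambda>v. \<Sum>i\<in>UNIV. \<bar>v $ i\<bar>)" by (intro continuous_intros)
    ultimately obtain v where v: "v \<in> Q" "\<And>u. u \<in> Q \<Longrightarrow> (\<Sum>i\<in>UNIV. \<bar>v $ i\<bar>) \<le> (\<Sum>i\<in>UNIV. \<bar>u $ i\<bar>)"
      using continuous_attains_inf[of Q "\<lambda>v. \<Sum>i\<in>UNIV. \<bar>v $ i\<bar>"] by blast
    define p where "p = ({i. 0 < v $ i}, {i. v $ i < 0})"
    have "v \<in> orth p" unfolding p_def orth_def by auto
    moreover have "inj p"
      unfolding inj_def
    proof (intro ballI impI, rule ccontr)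
      fix z assume z: "z \<in> orth p" "E *v z = 0" "z \<noteq> 0"
      have sgn: "(0 < z $ i \<longrightarrow> 0 < v $ i) \<and> (z $ i < 0 \<longrightarrow> v $ i < 0)" for i
        using z(1) unfolding orth_def p_def
        by (cases "0 < v $ i"; cases "v $ i < 0") (auto simp: not_less dest!: spec[of _ i] bspec[of _ _ i])
      \<comment> \<open>a positive step along \<open>- z\<close> on which no component of \<open>v\<close> changes its sign\<close>
      define e where "e = Min (range (\<lambda>i. if z $ i = 0 then 1 else v $ i / z $ i))"
      have epos: "0 < e"
        unfolding e_def using sgn
        by (subst Min_gr_iff) (auto simp: zero_less_divide_iff linorder_neq_iff)
      have ele: "z $ i \<noteq> 0 \<Longrightarrow> e \<le> v $ i / z $ i" for i
        unfolding e_def by (rule Min_le) (auto intro!: rev_image_eqI[of i])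
      have step: "(0 < z $ i \<longrightarrow> 0 \<le> v $ i - e * z $ i \<and> v $ i - e * z $ i < v $ i) \<and>
          (z $ i < 0 \<longrightarrow> v $ i - e * z $ i \<le> 0 \<and> v $ i < v $ i - e * z $ i)" for i
        using ele[of i] epos by (auto simp: field_simps mult_less_0_iff)
      have between: "min 0 (w $ i) \<le> v $ i \<and> v $ i \<le> max 0 (w $ i)" for i using v(1) Q by blast
      have "v - e *\<^sub>R z \<in> Q"
        unfolding Q
      proof (intro conjI allI)
        show "E *v (v - e *\<^sub>R z) = E *v w"
          using v(1) z(2) by (simp add: Q matrix_vector_mult_diff_distrib matrix_vector_mult_scaleR)
        fix i
        show "min 0 (w $ i) \<le> (v - e *\<^sub>R z) $ i" "(v - e *\<^sub>R z) $ i \<le> max 0 (w $ i)"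
          using step[of i] between[of i] sgn[of i] by (cases "z $ i" "0::real" rule: linorder_cases; force)+
      qed
      from v(2)[OF this] have "(\<Sum>i\<in>UNIV. \<bar>v $ i\<bar>) \<le> (\<Sum>i\<in>UNIV. \<bar>v $ i - e * z $ i\<bar>)" by simp
      moreover have "(\<Sum>i\<in>UNIV. \<bar>v $ i - e * z $ i\<bar>) < (\<Sum>i\<in>UNIV. \<bar>v $ i\<bar>)"
      proof (rule sum_strict_mono_ex1)
        show "\<forall>i\<in>UNIV. \<bar>v $ i - e * z $ i\<bar> \<le> \<bar>v $ i\<bar>"
        proof
          fix i show "\<bar>v $ i - e * z $ i\<bar> \<le> \<bar>v $ i\<bar>"
            using step[of i] sgn[of i] by (cases "z $ i" "0::real" rule: linorder_cases) auto
        qed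
        obtain i where "z $ i \<noteq> 0" using z(3) by (auto simp: vec_eq_iff)
        then show "\<exists>i\<in>UNIV. \<bar>v $ i - e * z $ i\<bar> < \<bar>v $ i\<bar>"
          using step[of i] sgn[of i] by (intro bexI[of _ i]) (cases "z $ i" "0::real" rule: linorder_cases; auto)+
      qed auto
      ultimately show False by simp
    qed
    ultimately have "norm v \<le> c p * norm (E *v v)" using c(2) by blast
    also have "\<dots> \<le> k * norm (E *v w)"
      using v(1) ck[of p] by (auto simp: Q intro: mult_right_mono)
    finally show ?thesis using v(1) Q by blast
  qed
  then show ?thesis using kpos by blast
qed

section \<open>Coordinatewise optimality\<close>

text \<open>The nonsmooth part of the objective is separable. Its component at \<open>i\<close> is \<open>pen S lam i\<close> on
  the closed convex cone described by \<open>adm S i\<close>.\<close>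

definition pen :: "'n set \<Rightarrow> real \<Rightarrow> 'n \<Rightarrow> real \<Rightarrow> real" where
  "pen S lam i u = (if i \<in> S then lam * \<bar>u\<bar> else 0)"

definition adm :: "'n set \<Rightarrow> 'n \<Rightarrow> real \<Rightarrow> bool" where
  "adm S i u \<longleftrightarrow> i \<in> S \<or> 0 \<le> u"

definition obj ::
  "(real ^ 'm \<Rightarrow> real) \<Rightarrow> real ^ 'n ^ 'm \<Rightarrow> 'n set \<Rightarrow> real \<Rightarrow> real ^ 'n \<Rightarrow> real" where
  "obj h E S lam z = h (E *v z) + (\<Sum>i\<in>UNIV. pen S lam i (z $ i))"

text \<open>The inclusion \<open>- d \<in> \<partial>\<phi>(v)\<close> for \<open>\<phi>\<close> equal to \<open>pen S lam i\<close> on the cone and to \<open>\<infinity>\<close>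
  elsewhere: since \<open>\<phi>\<close> is convex and positively homogeneous, its conjugate takes only the values \<open>0\<close> and
  \<open>\<infinity>\<close>, and equality in the Fenchel inequality has the form stated.\<close>

definition coord_opt :: "'n set \<Rightarrow> real \<Rightarrow> 'n \<Rightarrow> real \<Rightarrow> real \<Rightarrow> bool" where
  "coord_opt S lam i d v \<longleftrightarrow>
     adm S i v \<and> pen S lam i v + d * v = 0 \<and> (\<forall>u. adm S i u \<longrightarrow> 0 \<le> pen S lam i u + d * u)"

lemma feasible_iff_adm: "z \<in> feasible S \<longleftrightarrow> (\<forall>i. adm S i (z $ i))"
  by (auto simp: feasible_def adm_def)

lemma sum_pen:
  fixes z :: "real ^ 'n"
  shows "(\<Sum>i\<in>UNIV. pen S lam i (z $ i)) = lam * (\<Sum>i\<in>S. \<bar>z $ i\<bar>)"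
  unfolding pen_def by (simp add: sum.If_cases sum_distrib_left)

lemma inner_matrix_vector_mult_columns:
  fixes E :: "real ^ 'n ^ 'm"
  shows "p \<bullet> (E *v z) = (\<Sum>i\<in>UNIV. (column i E \<bullet> p) * z $ i)"
  by (simp add: matrix_mult_sum inner_sum_right scalar_mult_eq_scaleR inner_commute mult.commute)

lemma coord_opt_if_variational:
  assumes v: "adm S i v"
    and var: "\<And>u. adm S i u \<Longrightarrow> 0 \<le> pen S lam i u - pen S lam i v + d * (u - v)"
  shows "coord_opt S lam i d v"
proof -
  \<comment> \<open>the multiples \<open>0\<close> and \<open>2 * v\<close> of \<open>v\<close> turn the inequality into an equation at \<open>v\<close>\<close>
  have "adm S i 0" "adm S i (2 * v)" using v by (auto simp: adm_def)
  from this[THEN var] have "pen S lam i v + d * v = 0"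
    by (auto simp: pen_def algebra_simps split: if_splits)
  moreover have "0 \<le> pen S lam i u + d * u" if "adm S i u" for u
    using var[OF that] calculation by (simp add: algebra_simps)
  ultimately show ?thesis using v unfolding coord_opt_def by blast
qed

lemma coord_opt_between:
  assumes "coord_opt S lam i d a" "coord_opt S lam i d b" "min a b \<le> c" "c \<le> max a b"
  shows "coord_opt S lam i d c"
proof -
  have "adm S i a" "adm S i b" using assms(1,2) unfolding coord_opt_def by simp_all
  then have adm: "adm S i c" using assms(3) unfolding adm_def by linarith
  have eq: "pen S lam i a + d * a = 0" "pen S lam i b + d * b = 0"
    using assms(1,2) unfolding coord_opt_def by simp_all
  have "pen S lam i c + d * c = 0"
  proof (cases c "0::real" rule: linorder_cases)
    case less
    then have "a < 0 \<or> b < 0" using assms(3) by linarith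
    then obtain e where "e < 0" "pen S lam i e + d * e = 0" using eq by blast
    moreover from this have "i \<in> S \<Longrightarrow> (d - lam) * e = 0" "i \<notin> S \<Longrightarrow> d * e = 0"
      by (simp_all add: pen_def algebra_simps)
    ultimately show ?thesis using less by (cases "i \<in> S") (simp_all add: pen_def)
  next
    case greater
    then have "0 < a \<or> 0 < b" using assms(4) by linarith
    then obtain e where "0 < e" "pen S lam i e + d * e = 0" using eq by blast
    moreover from this have "i \<in> S \<Longrightarrow> (d + lam) * e = 0" "i \<notin> S \<Longrightarrow> d * e = 0"
      by (simp_all add: pen_def algebra_simps)
    ultimately have "i \<in> S \<Longrightarrow> d = - lam" "i \<notin> S \<Longrightarrow> d = 0" by auto
    then show ?thesis using greater by (cases "i \<in> S") (simp_all add: pen_def)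
  qed (simp add: pen_def)
  with adm show ?thesis using assms(1) unfolding coord_opt_def by simp
qed

text \<open>Complementarity is stable because \<open>pen S lam i\<close> is linear on either side of \<open>0\<close>: a nonzero
  \<open>v\<close> forces \<open>D\<close> to be a number determined by the sign of \<open>v\<close>. If \<open>d\<close> differs from that number,
  a slope close to \<open>d\<close> excludes the sign; otherwise \<open>d = D\<close>.\<close>

lemma coord_opt_stable:
  "\<exists>e>0. \<forall>D v. \<bar>D - d\<bar> < e \<and> coord_opt S lam i D v \<longrightarrow> pen S lam i v + d * v = 0"
proof -
  define cp where "cp = - pen S lam i 1"
  define cm where "cm = pen S lam i (- 1)"
  define e where "e = min (if d = cp then 1 else \<bar>d - cp\<bar>) (if d = cm then 1 else \<bar>d - cm\<bar>)"
  have "e > 0" by (auto simp: e_def)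
  moreover have "pen S lam i v + d * v = 0" if D: "\<bar>D - d\<bar> < e" "coord_opt S lam i D v" for D v
  proof (cases v "0::real" rule: linorder_cases)
    case less
    have "pen S lam i v + D * v = 0" using D(2) unfolding coord_opt_def by blast
    moreover have "pen S lam i v = - cm * v" using less by (simp add: cm_def pen_def)
    ultimately have "(D - cm) * v = 0" by (simp add: algebra_simps)
    then have "D = cm" using less by simp
    with D(1) have "d = cm" by (auto simp: e_def split: if_splits)
    with \<open>pen S lam i v = - cm * v\<close> show ?thesis by simp
  next
    case greater
    have "pen S lam i v + D * v = 0" using D(2) unfolding coord_opt_def by blast
    moreover have "pen S lam i v = - cp * v" using greater by (simp add: cp_def pen_def)
    ultimately have "(D - cp) * v = 0" by (simp add: algebra_simps)
    then have "D = cp" using greater by simp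
    with D(1) have "d = cp" by (auto simp: e_def split: if_splits)
    with \<open>pen S lam i v = - cp * v\<close> show ?thesis by simp
  qed (simp add: pen_def)
  ultimately show ?thesis by blast
qed

text \<open>The next two facts replace the nonsmooth part by a linear function of the image: slopes
  that are subgradients of the penalties bound the objective from below by a tilted copy of \<open>h\<close>,
  with equality under complementarity.\<close>

lemma obj_ge_tilted:
  fixes E :: "real ^ 'n ^ 'm"
  assumes "\<And>i u. adm S i u \<Longrightarrow> 0 \<le> pen S lam i u + (column i E \<bullet> p) * u" "z \<in> feasible S"
  shows "h (E *v z) - p \<bullet> (E *v z) \<le> obj h E S lam z"
proof -
  have "0 \<le> (\<Sum>i\<in>UNIV. pen S lam i (z $ i) + (column i E \<bullet> p) * z $ i)"
    using assms by (intro sum_nonneg) (auto simp: feasible_iff_adm)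
  then show ?thesis
    unfolding obj_def inner_matrix_vector_mult_columns by (simp add: sum.distrib)
qed

lemma obj_eq_tilted:
  fixes E :: "real ^ 'n ^ 'm"
  assumes "\<And>i. pen S lam i (z $ i) + (column i E \<bullet> p) * z $ i = 0"
  shows "obj h E S lam z = h (E *v z) - p \<bullet> (E *v z)"
proof -
  have "(\<Sum>i\<in>UNIV. pen S lam i (z $ i) + (column i E \<bullet> p) * z $ i) = 0"
    using assms by simp
  then show ?thesis
    unfolding obj_def inner_matrix_vector_mult_columns by (simp add: sum.distrib)
qed

lemma matrix_vector_mult_axis_add:
  fixes E :: "real ^ 'n ^ 'm"
  shows "E *v (y + axis i a) = E *v y + a *\<^sub>R column i E"
proof -
  have "axis i a = a *\<^sub>R axis i (1::real)"
    by (simp add: vec_eq_iff axis_def)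
  then show ?thesis
    by (simp add: matrix_vector_right_distrib matrix_vector_mult_scaleR matrix_vector_mult_basis)
qed

lemma obj_axis_add:
  fixes E :: "real ^ 'n ^ 'm"
  shows "obj h E S lam (y + axis i a) =
    h (E *v y + a *\<^sub>R column i E) + (\<Sum>j\<in>UNIV. pen S lam j (y $ j))
      + (pen S lam i (y $ i + a) - pen S lam i (y $ i))"
proof -
  have "(\<Sum>j\<in>UNIV. pen S lam j ((y + axis i a) $ j)) - (\<Sum>j\<in>UNIV. pen S lam j (y $ j))
      = (\<Sum>j\<in>UNIV. if j = i then pen S lam i (y $ i + a) - pen S lam i (y $ i) else 0)"
    unfolding sum_subtractf[symmetric] by (intro sum.cong) (auto simp: axis_def)
  then show ?thesis
    by (simp add: obj_def matrix_vector_mult_axis_add)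
qed

text \<open>Moving from \<open>y $ i\<close> towards an admissible \<open>u\<close> does not decrease the objective. To first
  order the penalty changes by at most \<open>pen S lam i u - pen S lam i (y $ i)\<close>, by convexity, and
  the smooth part by its directional derivative.\<close>

lemma coord_opt_if_coordinate_minimizer:
  fixes E :: "real ^ 'n ^ 'm"
  assumes "open C" and Ey: "E *v y \<in> C"
    and deriv: "GDERIV h (E *v y) :> D"
    and "0 \<le> lam" and y: "y \<in> feasible S"
    and min: "\<And>z. z \<in> feasible S \<Longrightarrow> \<forall>j. j \<noteq> i \<longrightarrow> z $ j = y $ j \<Longrightarrow> E *v z \<in> C \<Longrightarrow>
                obj h E S lam y \<le> obj h E S lam z"
  shows "coord_opt S lam i (column i E \<bullet> D) (y $ i)"
proof (rule coord_opt_if_variational)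
  show "adm S i (y $ i)" using y by (simp add: feasible_iff_adm)
next
  fix u assume u: "adm S i u"
  define a where "a = u - y $ i"
  define q where "q = pen S lam i u - pen S lam i (y $ i)"
  define w where "w = a *\<^sub>R column i E"
  define \<psi> where "\<psi> r = h (E *v y + r *\<^sub>R w) + r * q" for r
  have line: "((\<lambda>r. E *v y + r *\<^sub>R w) has_derivative (\<lambda>r. r *\<^sub>R w)) (at 0)"
    by (auto intro!: derivative_eq_intros)
  have "(h has_derivative (\<lambda>v. v \<bullet> D)) (at (E *v y + 0 *\<^sub>R w))"
    using deriv unfolding gderiv_def by simp
  from has_derivative_compose[OF line this]
  have "DERIV (\<lambda>r. h (E *v y + r *\<^sub>R w)) 0 :> w \<bullet> D"
    by (simp add: has_field_derivative_def mult_commute_abs)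
  then have d: "DERIV \<psi> 0 :> w \<bullet> D + q"
    unfolding \<psi>_def by (auto intro!: derivative_eq_intros)
  have "continuous (at 0) (\<lambda>r. E *v y + r *\<^sub>R w)"
    by (intro continuous_intros)
  then have "\<forall>\<^sub>F r in nhds 0. E *v y + r *\<^sub>R w \<in> C"
    using \<open>open C\<close> Ey by (auto simp: continuous_at_open isCont_def tendsto_def eventually_nhds)
  then obtain e where e: "e > 0" "\<And>r. \<bar>r\<bar> < e \<Longrightarrow> E *v y + r *\<^sub>R w \<in> C"
    by (auto simp: eventually_nhds_metric dist_real_def)
  have ge: "\<psi> 0 \<le> \<psi> r" if r: "0 < r" "r < min e 1" for r
  proof -
    let ?z = "y + axis i (r * a)"
    have yi: "y $ i + r * a = (1 - r) * y $ i + r * u" by (simp add: a_def algebra_simps)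
    have "adm S i (y $ i + r * a)"
      using u y r unfolding yi feasible_iff_adm adm_def by (auto intro!: add_nonneg_nonneg)
    then have "?z \<in> feasible S"
      using y by (auto simp: feasible_iff_adm axis_def)
    moreover have "E *v ?z = E *v y + r *\<^sub>R w"
      by (simp add: matrix_vector_mult_axis_add w_def)
    ultimately have "obj h E S lam y \<le> obj h E S lam ?z"
      using e(2)[of r] r by (intro min) (auto simp: axis_def)
    then have "h (E *v y) \<le> h (E *v y + r *\<^sub>R w) + (pen S lam i (y $ i + r * a) - pen S lam i (y $ i))"
      unfolding obj_axis_add by (simp add: obj_def w_def)
    moreover have "pen S lam i (y $ i + r * a) \<le> (1 - r) * pen S lam i (y $ i) + r * pen S lam i u"
    proof (cases "i \<in> S")
      case True
      have "\<bar>(1 - r) * y $ i + r * u\<bar> \<le> (1 - r) * \<bar>y $ i\<bar> + r * \<bar>u\<bar>"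
        using r abs_triangle_ineq[of "(1 - r) * y $ i" "r * u"] by (simp add: abs_mult)
      from mult_left_mono[OF this \<open>0 \<le> lam\<close>] show ?thesis
        unfolding yi using True by (simp add: pen_def algebra_simps)
    qed (simp add: pen_def)
    ultimately show ?thesis by (simp add: \<psi>_def q_def algebra_simps)
  qed
  have "0 \<le> w \<bullet> D + q"
  proof (rule ccontr)
    assume "\<not> ?thesis"
    then obtain \<delta> where \<delta>: "\<delta> > 0" "\<And>r. 0 < r \<Longrightarrow> r < \<delta> \<Longrightarrow> \<psi> (0 + r) < \<psi> 0"
      using DERIV_neg_dec_right[OF d] by auto
    define r where "r = min \<delta> (min e 1) / 2"
    have "0 < r" "r < \<delta>" "r < min e 1" using \<delta>(1) e(1) by (auto simp: r_def)
    with \<delta>(2)[of r] ge[of r] show False by simp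
  qed
  then show "0 \<le> pen S lam i u - pen S lam i (y $ i) + (column i E \<bullet> D) * (u - y $ i)"
    by (simp add: w_def a_def q_def algebra_simps)
qed

section \<open>Estimates for one sweep\<close>

text \<open>Changing one coordinate to its minimizer decreases the objective at least by the quadratic
  term of strong convexity: the first-order terms have the right sign by coordinatewise
  optimality. Since each coordinate is changed exactly once, these gains add up to the squared
  length of the sweep.

  After the sweep a coordinate is still optimal, only with respect to the slope at the
  intermediate point where it was updated; that slope differs from the final one by at most a
  multiple of the length of the sweep.\<close>

lemma sweep_estimates:
  fixes E :: "real ^ 'n ^ 'm" and y :: "nat \<Rightarrow> real ^ 'n" and \<sigma> :: "nat \<Rightarrow> 'n"
  defines "n \<equiv> CARD('n)"
  assumes enum: "bij_betw \<sigma> {1..n} UNIV"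
    and feas: "\<And>i. i \<le> n \<Longrightarrow> y i \<in> feasible S"
    and inK: "\<And>i. i \<le> n \<Longrightarrow> E *v y i \<in> K"
    and other: "\<And>i j. i \<in> {1..n} \<Longrightarrow> j \<noteq> \<sigma> i \<Longrightarrow> y i $ j = y (i - 1) $ j"
    and opt: "\<And>i. i \<in> {1..n} \<Longrightarrow> coord_opt S lam (\<sigma> i) (column (\<sigma> i) E \<bullet> dh (E *v y i)) (y i $ \<sigma> i)"
    and strong: "\<And>s t. s \<in> K \<Longrightarrow> t \<in> K \<Longrightarrow> h t + dh t \<bullet> (s - t) + c * (norm (s - t))\<^sup>2 \<le> h s"
    and lip: "\<And>s t. s \<in> K \<Longrightarrow> t \<in> K \<Longrightarrow> norm (dh s - dh t) \<le> L * norm (s - t)"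
    and "0 \<le> c" "0 \<le> L" "0 \<le> b" "0 \<le> B"
    and col_ge: "\<And>j. b \<le> norm (column j E)"
    and col_le: "\<And>j. norm (column j E) \<le> B"
    and mat_le: "\<And>v. norm (E *v v) \<le> B * norm v"
  shows "obj h E S lam (y n) + c * b\<^sup>2 * (norm (y n - y 0))\<^sup>2 \<le> obj h E S lam (y 0)"
    and "\<exists>D. coord_opt S lam j D (y n $ j) \<and>
      \<bar>D - column j E \<bullet> dh (E *v y n)\<bar> \<le> B * L * B * norm (y n - y 0)"
proof -
  have inj: "\<sigma> i \<noteq> \<sigma> k" if "i \<in> {1..n}" "k \<in> {1..n}" "i \<noteq> k" for i k
    using bij_betw_imp_inj_on[OF enum] that by (meson inj_onD)
  have before: "k < i \<longrightarrow> y k $ \<sigma> i = y 0 $ \<sigma> i" if i: "i \<in> {1..n}" for i k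
  proof (induction k)
    case (Suc k)
    show ?case
    proof
      assume k: "Suc k < i"
      then have "\<sigma> i \<noteq> \<sigma> (Suc k)" using i by (intro inj) auto
      then have "y (Suc k) $ \<sigma> i = y k $ \<sigma> i" using other[of "Suc k"] k i by auto
      then show "y (Suc k) $ \<sigma> i = y 0 $ \<sigma> i" using Suc k by simp
    qed
  qed simp
  have after: "k \<le> n \<longrightarrow> y k $ \<sigma> i = y i $ \<sigma> i" if i: "i \<in> {1..n}" and "i \<le> k" for i k
    using \<open>i \<le> k\<close>
  proof (induction k rule: dec_induct)
    case (step k)
    show ?case
    proof
      assume k: "Suc k \<le> n"
      then have "\<sigma> i \<noteq> \<sigma> (Suc k)" using i step.hyps by (intro inj) auto
      then have "y (Suc k) $ \<sigma> i = y k $ \<sigma> i" using other[of "Suc k"] k by auto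
      then show "y (Suc k) $ \<sigma> i = y i $ \<sigma> i" using step.IH k by simp
    qed
  qed simp
  have final: "y i $ \<sigma> i = y n $ \<sigma> i" if "i \<in> {1..n}" for i
    using after[OF that, of n] that by auto
  have gain: "obj h E S lam (y i) + c * b\<^sup>2 * (y n $ \<sigma> i - y 0 $ \<sigma> i)\<^sup>2 \<le> obj h E S lam (y (i - 1))"
    if i: "i \<in> {1..n}" for i
  proof -
    let ?j = "\<sigma> i" and ?t = "E *v y i"
    define d where "d = column ?j E \<bullet> dh ?t"
    define a where "a = y (i - 1) $ ?j - y i $ ?j"
    have a: "a = - (y n $ ?j - y 0 $ ?j)"
      using before[OF i, of "i - 1"] final[OF i] i by (simp add: a_def)
    have prev: "y (i - 1) = y i + axis ?j a"
      using other[OF i] by (auto simp: vec_eq_iff axis_def a_def)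
    have "h ?t + dh ?t \<bullet> (a *\<^sub>R column ?j E) + c * (norm (a *\<^sub>R column ?j E))\<^sup>2
        \<le> h (?t + a *\<^sub>R column ?j E)"
      using strong[OF inK[of "i - 1"] inK[of i]] i
      unfolding prev matrix_vector_mult_axis_add by auto
    moreover have "dh ?t \<bullet> (a *\<^sub>R column ?j E) = d * a"
      by (simp add: d_def inner_commute)
    moreover have "c * b\<^sup>2 * a\<^sup>2 \<le> c * (norm (a *\<^sub>R column ?j E))\<^sup>2"
    proof -
      have "b\<^sup>2 \<le> (norm (column ?j E))\<^sup>2" using col_ge \<open>0 \<le> b\<close> by (rule power_mono)
      then have "c * (b\<^sup>2 * a\<^sup>2) \<le> c * ((norm (column ?j E))\<^sup>2 * a\<^sup>2)"
        using \<open>0 \<le> c\<close> by (intro mult_left_mono mult_right_mono) auto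
      then show ?thesis by (simp add: power_mult_distrib mult_ac)
    qed
    moreover have "- (d * a) \<le> pen S lam ?j (y i $ ?j + a) - pen S lam ?j (y i $ ?j)"
    proof -
      have "adm S ?j (y i $ ?j + a)"
        using feas[of "i - 1"] i by (auto simp: a_def feasible_iff_adm)
      with opt[OF i] have "0 \<le> pen S lam ?j (y i $ ?j + a) + d * (y i $ ?j + a)"
        "pen S lam ?j (y i $ ?j) + d * y i $ ?j = 0"
        unfolding coord_opt_def d_def by auto
      then show ?thesis by (simp add: algebra_simps)
    qed
    moreover have "c * b\<^sup>2 * (y n $ ?j - y 0 $ ?j)\<^sup>2 = c * b\<^sup>2 * a\<^sup>2"
      by (simp add: a power2_commute)
    ultimately show ?thesis
      unfolding prev obj_axis_add unfolding obj_def by linarith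
  qed
  have "k \<le> n \<longrightarrow> obj h E S lam (y k) + c * b\<^sup>2 * (\<Sum>i=1..k. (y n $ \<sigma> i - y 0 $ \<sigma> i)\<^sup>2)
      \<le> obj h E S lam (y 0)" for k
  proof (induction k)
    case (Suc k)
    show ?case
    proof
      assume k: "Suc k \<le> n"
      with Suc gain[of "Suc k"]
      show "obj h E S lam (y (Suc k)) + c * b\<^sup>2 * (\<Sum>i=1..Suc k. (y n $ \<sigma> i - y 0 $ \<sigma> i)\<^sup>2)
        \<le> obj h E S lam (y 0)"
        by (simp add: distrib_left)
    qed
  qed simp
  moreover have "(\<Sum>i=1..n. (y n $ \<sigma> i - y 0 $ \<sigma> i)\<^sup>2) = (norm (y n - y 0))\<^sup>2"
  proof -
    have "(\<Sum>i\<in>{1..n}. (y n $ \<sigma> i - y 0 $ \<sigma> i)\<^sup>2) = (\<Sum>j\<in>UNIV. (y n $ j - y 0 $ j)\<^sup>2)"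
      using enum by (rule sum.reindex_bij_betw)
    also have "\<dots> = (norm (y n - y 0))\<^sup>2"
      unfolding power2_norm_eq_inner inner_vec_def by (simp add: power2_eq_square)
    finally show ?thesis .
  qed
  ultimately show "obj h E S lam (y n) + c * b\<^sup>2 * (norm (y n - y 0))\<^sup>2 \<le> obj h E S lam (y 0)"
    by fastforce
  obtain i where i: "i \<in> {1..n}" "\<sigma> i = j"
    using enum unfolding bij_betw_def by (metis UNIV_I imageE)
  have "norm (y i - y n) \<le> norm (y n - y 0)"
  proof (rule norm_le_componentwise_cart)
    fix l
    obtain k where k: "k \<in> {1..n}" "\<sigma> k = l"
      using enum unfolding bij_betw_def by (metis UNIV_I imageE)
    have "y i $ l = (if k \<le> i then y n $ l else y 0 $ l)"
      using after[OF k(1), of i] before[OF k(1), of i] final[OF k(1)] i(1) k(2) by auto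
    then show "norm ((y i - y n) $ l) \<le> norm ((y n - y 0) $ l)"
      by (auto simp: abs_minus_commute)
  qed
  then have len: "norm (E *v y i - E *v y n) \<le> B * norm (y n - y 0)"
    using mat_le[of "y i - y n"] \<open>0 \<le> B\<close>
    by (simp add: matrix_vector_mult_diff_distrib) (meson mult_left_mono order_trans)
  have "\<bar>column j E \<bullet> dh (E *v y i) - column j E \<bullet> dh (E *v y n)\<bar>
      \<le> norm (column j E) * norm (dh (E *v y i) - dh (E *v y n))"
    unfolding inner_diff_right[symmetric] by (rule Cauchy_Schwarz_ineq2)
  also have "\<dots> \<le> B * (L * (B * norm (y n - y 0)))"
  proof (rule mult_mono)
    have "norm (dh (E *v y i) - dh (E *v y n)) \<le> L * norm (E *v y i - E *v y n)"
      using lip inK i(1) by simp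
    also have "\<dots> \<le> L * (B * norm (y n - y 0))"
      using len \<open>0 \<le> L\<close> by (rule mult_left_mono)
    finally show "norm (dh (E *v y i) - dh (E *v y n)) \<le> L * (B * norm (y n - y 0))" .
  qed (use col_le \<open>0 \<le> B\<close> in auto)
  finally show "\<exists>D. coord_opt S lam j D (y n $ j) \<and>
      \<bar>D - column j E \<bullet> dh (E *v y n)\<bar> \<le> B * L * B * norm (y n - y 0)"
    using opt[OF i(1)] final[OF i(1)] i(2)
    by (intro exI[of _ "column j E \<bullet> dh (E *v y i)"]) (simp add: mult_ac)
qed

section \<open>Convergence of descent sequences\<close>

text \<open>If a decrease by a multiple of \<open>(d r)\<^sup>2\<close> leaves a gap \<open>e (Suc r)\<close> of the same order, then the
  gap contracts by a fixed factor, and \<open>d\<close> is dominated by a geometric sequence.\<close>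

lemma summable_if_linear_rate:
  fixes e d :: "nat \<Rightarrow> real"
  assumes "\<And>r. 0 \<le> e r" "\<And>r. 0 \<le> d r" and a: "0 < a" and "0 \<le> B"
    and dec: "\<And>r. a * (d r)\<^sup>2 \<le> e r - e (Suc r)"
    and rate: "\<And>r. R \<le> r \<Longrightarrow> e (Suc r) \<le> B * (d r)\<^sup>2"
  shows "summable d" "e \<longlonglongrightarrow> 0"
proof -
  define q where "q = B / (a + B)"
  have q: "0 \<le> q" "q < 1" using a \<open>0 \<le> B\<close> by (auto simp: q_def field_simps)
  have contract: "e (Suc r) \<le> q * e r" if "R \<le> r" for r
  proof -
    have "a * e (Suc r) \<le> a * (B * (d r)\<^sup>2)" using rate[OF that] a by simp
    also have "\<dots> = B * (a * (d r)\<^sup>2)" by simp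
    also have "\<dots> \<le> B * (e r - e (Suc r))" using dec \<open>0 \<le> B\<close> by (rule mult_left_mono)
    finally have "(a + B) * e (Suc r) \<le> B * e r" by (simp add: algebra_simps)
    then show ?thesis using a \<open>0 \<le> B\<close> by (simp add: q_def field_simps)
  qed
  have geo: "e (k + R) \<le> e R * q ^ k" for k
  proof (induction k)
    case (Suc k)
    have "e (Suc k + R) \<le> q * e (k + R)" using contract[of "k + R"] by simp
    also have "\<dots> \<le> q * (e R * q ^ k)" using Suc q(1) by (rule mult_left_mono)
    finally show ?case by (simp add: mult_ac)
  qed simp
  have "norm (d (k + R)) \<le> sqrt (e R / a) * sqrt q ^ k" for k
  proof -
    have "a * (d (k + R))\<^sup>2 \<le> e R * q ^ k"
      using dec[of "k + R"] assms(1)[of "Suc (k + R)"] geo[of k] by linarith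
    then have "(d (k + R))\<^sup>2 \<le> e R / a * q ^ k" using a by (simp add: field_simps)
    then have "sqrt ((d (k + R))\<^sup>2) \<le> sqrt (e R / a * q ^ k)" by (rule real_sqrt_le_mono)
    moreover have "sqrt (e R / a * q ^ k) = sqrt (e R / a) * sqrt q ^ k"
      by (simp only: real_sqrt_mult real_sqrt_power)
    ultimately show ?thesis by (simp only: real_sqrt_abs real_norm_def)
  qed
  moreover have "summable (\<lambda>k. sqrt (e R / a) * sqrt q ^ k)"
    using q by (intro summable_mult summable_geometric) simp
  ultimately have "summable (\<lambda>k. d (k + R))" by (rule summable_comparison_test'[rotated])
  then show "summable d" by (simp add: summable_iff_shift)
  have "(\<lambda>k. e R * q ^ k) \<longlonglongrightarrow> e R * 0"
    using q by (intro tendsto_intros LIMSEQ_realpow_zero)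
  then have lim0: "(\<lambda>k. e R * q ^ k) \<longlonglongrightarrow> 0" by simp
  have "(\<lambda>k. e (k + R)) \<longlonglongrightarrow> 0"
    by (rule tendsto_sandwich[OF _ _ tendsto_const lim0])
       (use geo assms(1) in \<open>auto intro!: always_eventually\<close>)
  then show "e \<longlonglongrightarrow> 0" by (rule LIMSEQ_offset)
qed

text \<open>Convergence depends on the method only through sufficient decrease and approximate
  coordinatewise optimality, with an error controlled by the step. The minimizer \<open>xs\<close> serves to
  describe the optimal value and the optimal image; the iterates may converge to another one.\<close>

locale coordinate_descent =
  fixes E :: "real ^ 'n ^ 'm" and S :: "'n set" and lam :: real
    and h :: "real ^ 'm \<Rightarrow> real" and dh :: "real ^ 'm \<Rightarrow> real ^ 'm" and K :: "(real ^ 'm) set"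
    and c a M :: real and x :: "nat \<Rightarrow> real ^ 'n" and xs :: "real ^ 'n"
  assumes compact_K: "compact K"
    and cont_h: "continuous_on K h" and cont_dh: "continuous_on K dh"
    and c_pos: "0 < c" and a_pos: "0 < a" and M_nonneg: "0 \<le> M"
    and strong: "\<And>s t. s \<in> K \<Longrightarrow> t \<in> K \<Longrightarrow> h t + dh t \<bullet> (s - t) + c * (norm (s - t))\<^sup>2 \<le> h s"
    and feas: "\<And>r. x r \<in> feasible S" and inK: "\<And>r. E *v x r \<in> K"
    and xs_feas: "xs \<in> feasible S" and xs_inK: "E *v xs \<in> K"
    and xs_opt: "\<And>j. coord_opt S lam j (column j E \<bullet> dh (E *v xs)) (xs $ j)"
    and decrease: "\<And>r. obj h E S lam (x (Suc r)) + a * (norm (x (Suc r) - x r))\<^sup>2 \<le> obj h E S lam (x r)"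
    and near_opt: "\<And>r j. \<exists>D. coord_opt S lam j D (x (Suc r) $ j) \<and>
        \<bar>D - column j E \<bullet> dh (E *v x (Suc r))\<bar> \<le> M * norm (x (Suc r) - x r)"
begin

abbreviation F :: "real ^ 'n \<Rightarrow> real" where "F \<equiv> obj h E S lam"
abbreviation ts :: "real ^ 'm" where "ts \<equiv> E *v xs"

lemma F_xs: "F xs = h ts - dh ts \<bullet> ts"
  using xs_opt unfolding coord_opt_def by (intro obj_eq_tilted) blast

lemma quadratic_growth:
  assumes "z \<in> feasible S" "E *v z \<in> K"
  shows "F xs + c * (norm (E *v z - ts))\<^sup>2 \<le> F z"
proof -
  have "h (E *v z) - dh ts \<bullet> (E *v z) \<le> F z"
    using xs_opt unfolding coord_opt_def by (intro obj_ge_tilted assms) blast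
  with strong[OF assms(2) xs_inK] show ?thesis
    by (simp add: F_xs inner_diff_right)
qed

lemma F_ge: "F xs \<le> F (x r)"
proof -
  have "0 \<le> c * (norm (E *v x r - ts))\<^sup>2" using c_pos by simp
  with quadratic_growth[OF feas inK, of r] show ?thesis by linarith
qed

lemma steps_tendsto_0: "(\<lambda>r. norm (x (Suc r) - x r)) \<longlonglongrightarrow> 0"
proof -
  have dec: "F (x (Suc r)) \<le> F (x r)" for r
  proof -
    have "0 \<le> a * (norm (x (Suc r) - x r))\<^sup>2" using a_pos by simp
    with decrease[of r] show ?thesis by linarith
  qed
  then have "decseq (\<lambda>r. F (x r))" by (rule decseq_SucI)
  then obtain l where l: "(\<lambda>r. F (x r)) \<longlonglongrightarrow> l"
    using decseq_convergent[of "\<lambda>r. F (x r)" "F xs"] F_ge by blast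
  have "(\<lambda>r. (F (x r) - F (x (Suc r))) / a) \<longlonglongrightarrow> (l - l) / a"
    using a_pos by (intro tendsto_intros l LIMSEQ_Suc[OF l]) simp
  then have lim0: "(\<lambda>r. (F (x r) - F (x (Suc r))) / a) \<longlonglongrightarrow> 0" by simp
  have "(\<lambda>r. (norm (x (Suc r) - x r))\<^sup>2) \<longlonglongrightarrow> 0"
  proof (rule tendsto_sandwich[OF _ _ tendsto_const lim0])
    have "(norm (x (Suc r) - x r))\<^sup>2 \<le> (F (x r) - F (x (Suc r))) / a" for r
      using decrease[of r] a_pos by (simp add: field_simps)
    then show "\<forall>\<^sub>F r in sequentially. (norm (x (Suc r) - x r))\<^sup>2 \<le> (F (x r) - F (x (Suc r))) / a"
      by simp
  qed simp
  then have "(\<lambda>r. sqrt ((norm (x (Suc r) - x r))\<^sup>2)) \<longlonglongrightarrow> sqrt 0"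
    by (rule tendsto_real_sqrt)
  then show ?thesis by simp
qed

text \<open>If the images converge, even to a point not yet known to be optimal, then all slopes
  converge and the coordinates eventually satisfy the complementarity condition for the
  limiting slopes.\<close>

lemma identification:
  assumes q: "filterlim q at_top sequentially"
    and l: "l \<in> K" "(\<lambda>n. E *v x (Suc (q n))) \<longlonglongrightarrow> l"
  shows "adm S j u \<Longrightarrow> 0 \<le> pen S lam j u + (column j E \<bullet> dh l) * u"
    and "\<forall>\<^sub>F n in sequentially. \<forall>j. pen S lam j (x (Suc (q n)) $ j)
           + (column j E \<bullet> dh l) * x (Suc (q n)) $ j = 0"
proof -
  have "\<forall>r j. \<exists>D. coord_opt S lam j D (x (Suc r) $ j) \<and>
      \<bar>D - column j E \<bullet> dh (E *v x (Suc r))\<bar> \<le> M * norm (x (Suc r) - x r)"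
    using near_opt by blast
  then obtain D where D: "\<And>r j. coord_opt S lam j (D r j) (x (Suc r) $ j)"
    "\<And>r j. \<bar>D r j - column j E \<bullet> dh (E *v x (Suc r))\<bar> \<le> M * norm (x (Suc r) - x r)"
    unfolding choice_iff by blast
  have lim: "(\<lambda>n. D (q n) j) \<longlonglongrightarrow> column j E \<bullet> dh l" for j
  proof -
    have "(\<lambda>n. norm (x (Suc (q n)) - x (q n))) \<longlonglongrightarrow> 0"
      using filterlim_compose[OF steps_tendsto_0 q] .
    then have "(\<lambda>n. M * norm (x (Suc (q n)) - x (q n))) \<longlonglongrightarrow> M * 0"
      by (intro tendsto_intros)
    then have "(\<lambda>n. M * norm (x (Suc (q n)) - x (q n))) \<longlonglongrightarrow> 0" by simp
    then have "(\<lambda>n. D (q n) j - column j E \<bullet> dh (E *v x (Suc (q n)))) \<longlonglongrightarrow> 0"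
      by (rule Lim_null_comparison[rotated]) (use D(2) in \<open>auto intro!: always_eventually\<close>)
    moreover have "(\<lambda>n. dh (E *v x (Suc (q n)))) \<longlonglongrightarrow> dh l"
      using inK by (intro continuous_on_tendsto_compose[OF cont_dh l(2,1)]) auto
    then have "(\<lambda>n. column j E \<bullet> dh (E *v x (Suc (q n)))) \<longlonglongrightarrow> column j E \<bullet> dh l"
      by (intro tendsto_intros)
    ultimately have "(\<lambda>n. (D (q n) j - column j E \<bullet> dh (E *v x (Suc (q n))))
        + column j E \<bullet> dh (E *v x (Suc (q n)))) \<longlonglongrightarrow> 0 + column j E \<bullet> dh l"
      by (rule tendsto_add)
    then show ?thesis by simp
  qed
  show "0 \<le> pen S lam j u + (column j E \<bullet> dh l) * u" if "adm S j u"
  proof (rule LIMSEQ_le_const)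
    show "(\<lambda>n. pen S lam j u + D (q n) j * u) \<longlonglongrightarrow> pen S lam j u + (column j E \<bullet> dh l) * u"
      by (intro tendsto_intros lim)
    show "\<exists>N. \<forall>n\<ge>N. 0 \<le> pen S lam j u + D (q n) j * u"
      using D(1) that unfolding coord_opt_def by simp
  qed
  have "\<forall>\<^sub>F n in sequentially. pen S lam j (x (Suc (q n)) $ j)
      + (column j E \<bullet> dh l) * x (Suc (q n)) $ j = 0" for j
  proof -
    obtain e where e: "e > 0" "\<And>D v. \<bar>D - column j E \<bullet> dh l\<bar> < e \<Longrightarrow> coord_opt S lam j D v \<Longrightarrow>
        pen S lam j v + (column j E \<bullet> dh l) * v = 0"
      using coord_opt_stable[of "column j E \<bullet> dh l" S lam j] by blast
    have "\<forall>\<^sub>F n in sequentially. dist (D (q n) j) (column j E \<bullet> dh l) < e"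
      using lim e(1) by (rule tendstoD)
    then show ?thesis
      by (rule eventually_mono) (use e(2) D(1) in \<open>simp add: dist_real_def\<close>)
  qed
  then show "\<forall>\<^sub>F n in sequentially. \<forall>j. pen S lam j (x (Suc (q n)) $ j)
           + (column j E \<bullet> dh l) * x (Suc (q n)) $ j = 0"
    by (simp add: eventually_all_finite)
qed

text \<open>By identification the objective at the iterates is eventually the tilted value
  \<open>h t - dh l \<bullet> t\<close> of their images, so the optimal value is at most \<open>h l - dh l \<bullet> l\<close>. It is also
  at least the tilted value of \<open>ts\<close>, and the tilted function has its only minimum on \<open>K\<close> at its
  critical point \<open>l\<close>.\<close>

lemma limit_point_eq_ts:
  assumes q: "filterlim q at_top sequentially"
    and l: "l \<in> K" "(\<lambda>n. E *v x (Suc (q n))) \<longlonglongrightarrow> l"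
  shows "l = ts"
proof -
  note ident = identification[OF q l]
  have "F xs \<le> h l - dh l \<bullet> l"
  proof (rule tendsto_lowerbound)
    show "(\<lambda>n. h (E *v x (Suc (q n))) - dh l \<bullet> (E *v x (Suc (q n)))) \<longlonglongrightarrow> h l - dh l \<bullet> l"
      using inK by (intro tendsto_intros l(2) continuous_on_tendsto_compose[OF cont_h l(2,1)]) auto
    show "\<forall>\<^sub>F n in sequentially. F xs \<le> h (E *v x (Suc (q n))) - dh l \<bullet> (E *v x (Suc (q n)))"
      using ident(2)
    proof eventually_elim
      case (elim n)
      then show ?case using F_ge[of "Suc (q n)"] by (subst obj_eq_tilted[symmetric]) auto
    qed
  qed simp
  moreover have "h ts - dh l \<bullet> ts \<le> F xs"
    using ident(1) xs_feas by (rule obj_ge_tilted)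
  moreover have "h l + dh l \<bullet> (ts - l) + c * (norm (ts - l))\<^sup>2 \<le> h ts"
    using xs_inK l(1) by (rule strong)
  ultimately have "c * (norm (ts - l))\<^sup>2 \<le> 0" by (simp add: inner_diff_right)
  then show "l = ts" using c_pos by (simp add: mult_le_0_iff)
qed

lemma images_tendsto: "(\<lambda>r. E *v x (Suc r)) \<longlonglongrightarrow> ts"
proof (rule ccontr)
  assume "\<not> ?thesis"
  then obtain e where e: "e > 0" "\<not> (\<forall>\<^sub>F r in sequentially. dist (E *v x (Suc r)) ts < e)"
    by (auto simp: tendsto_iff)
  from not_eventually_sequentiallyD[OF e(2)]
  obtain p :: "nat \<Rightarrow> nat" where p: "strict_mono p" "\<forall>n. e \<le> dist (E *v x (Suc (p n))) ts"
    by (auto simp: not_less)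
  have "\<forall>n. E *v x (Suc (p n)) \<in> K" using inK by blast
  with compact_K obtain l s where ls: "l \<in> K" "strict_mono s"
    "((\<lambda>n. E *v x (Suc (p n))) \<circ> s) \<longlonglongrightarrow> l"
    unfolding compact_eq_seq_compact_metric seq_compact_def by metis
  have "filterlim (p \<circ> s) at_top sequentially"
    using p(1) ls(2) by (intro filterlim_subseq strict_mono_o)
  then have "l = ts" using ls by (intro limit_point_eq_ts[of "p \<circ> s"]) (auto simp: o_def)
  with ls(3) have "(\<lambda>n. dist (E *v x (Suc (p (s n)))) ts) \<longlonglongrightarrow> 0"
    using tendsto_dist_iff[of "\<lambda>n. E *v x (Suc (p (s n)))"] by (simp add: o_def)
  then have "e \<le> 0" using p(2) by (intro LIMSEQ_le_const) auto
  with e(1) show False by simp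
qed

text \<open>The error bound for the optimal value. The conformal error bound moves the iterate to a
  minimizer \<open>z + v\<close> at a distance comparable with \<open>norm (ts - E *v z)\<close> while keeping every
  coordinate between that of the iterate and that of \<open>xs\<close>, so that complementarity is preserved.
  Comparing the objective there by convexity gives a bound by the product of this distance with
  the length of the step; the quadratic growth cancels one of the two factors.\<close>

lemma linear_rate:
  "\<exists>R B. 0 \<le> B \<and> (\<forall>r\<ge>R. F (x (Suc r)) - F xs \<le> B * (norm (x (Suc r) - x r))\<^sup>2)"
proof -
  obtain k where k: "k > 0" "\<And>w. \<exists>v. E *v v = E *v w \<and>
      (\<forall>i. min 0 (w $ i) \<le> v $ i \<and> v $ i \<le> max 0 (w $ i)) \<and> norm v \<le> k * norm (E *v w)"
    using conformal_error_bound[of E] by blast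
  define N where "N = real CARD('n) * M * k"
  have N: "0 \<le> N" using k(1) M_nonneg by (simp add: N_def)
  have "\<forall>\<^sub>F r in sequentially. \<forall>j. pen S lam j (x (Suc r) $ j)
          + (column j E \<bullet> dh ts) * x (Suc r) $ j = 0"
    by (rule identification(2)[OF filterlim_ident xs_inK images_tendsto])
  then obtain R where R: "\<And>r j. R \<le> r \<Longrightarrow> pen S lam j (x (Suc r) $ j)
          + (column j E \<bullet> dh ts) * x (Suc r) $ j = 0"
    by (auto simp: eventually_sequentially)
  have "F (x (Suc r)) - F xs \<le> N\<^sup>2 / c * (norm (x (Suc r) - x r))\<^sup>2" if r: "R \<le> r" for r
  proof -
    define z where "z = x (Suc r)"
    define \<delta> where "\<delta> = norm (x (Suc r) - x r)"
    define \<tau> where "\<tau> = norm (E *v z - ts)"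
    have z: "z \<in> feasible S" "E *v z \<in> K" using feas inK by (auto simp: z_def)
    obtain D where D: "\<And>j. coord_opt S lam j (D j) (z $ j)"
      "\<And>j. \<bar>D j - column j E \<bullet> dh (E *v z)\<bar> \<le> M * \<delta>"
      using near_opt[of _ r] unfolding z_def \<delta>_def by metis
    obtain v where v: "E *v v = E *v (xs - z)" "norm v \<le> k * norm (E *v (xs - z))"
      "\<And>i. min 0 ((xs - z) $ i) \<le> v $ i \<and> v $ i \<le> max 0 ((xs - z) $ i)"
      using k(2)[of "xs - z"] by blast
    have Ev: "E *v v = ts - E *v z" using v(1) by (simp add: matrix_vector_mult_diff_distrib)
    have vk: "norm v \<le> k * \<tau>"
      using v(2) by (simp add: matrix_vector_mult_diff_distrib \<tau>_def norm_minus_commute)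
    define w where "w = z + v"
    have w_opt: "coord_opt S lam j (column j E \<bullet> dh ts) (w $ j)" for j
    proof (rule coord_opt_between[OF _ xs_opt])
      show "coord_opt S lam j (column j E \<bullet> dh ts) (z $ j)"
        using z(1) R[OF r, of j] xs_opt[of j]
        unfolding coord_opt_def z_def feasible_iff_adm by simp
      show "min (z $ j) (xs $ j) \<le> w $ j" "w $ j \<le> max (z $ j) (xs $ j)"
        using v(3)[of j] by (auto simp: w_def)
    qed
    have Ew: "E *v w = ts" by (simp add: w_def Ev matrix_vector_right_distrib)
    have "F w = F xs"
      using w_opt unfolding coord_opt_def F_xs by (subst obj_eq_tilted[where p = "dh ts"]) (auto simp: Ew)
    have "F z - F w = h (E *v z) - h ts + (\<Sum>j\<in>UNIV. pen S lam j (z $ j) - pen S lam j (w $ j))"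
      by (simp add: obj_def Ew sum_subtractf)
    also have "\<dots> \<le> - (dh (E *v z) \<bullet> (E *v v)) + (\<Sum>j\<in>UNIV. D j * v $ j)"
    proof (intro add_mono sum_mono)
      have "0 \<le> c * (norm (ts - E *v z))\<^sup>2" using c_pos by simp
      with strong[OF xs_inK z(2)] show "h (E *v z) - h ts \<le> - (dh (E *v z) \<bullet> (E *v v))"
        unfolding Ev by linarith
      fix j
      have "adm S j (w $ j)" using w_opt unfolding coord_opt_def by blast
      with D(1)[of j] have "0 \<le> pen S lam j (w $ j) + D j * w $ j" "pen S lam j (z $ j) + D j * z $ j = 0"
        unfolding coord_opt_def by auto
      then show "pen S lam j (z $ j) - pen S lam j (w $ j) \<le> D j * v $ j"
        by (simp add: w_def algebra_simps)
    qed
    also have "\<dots> = (\<Sum>j\<in>UNIV. (D j - column j E \<bullet> dh (E *v z)) * v $ j)"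
      by (simp add: inner_matrix_vector_mult_columns left_diff_distrib sum_subtractf)
    also have "\<dots> \<le> (\<Sum>j\<in>(UNIV::'n set). M * \<delta> * norm v)"
    proof (rule sum_mono)
      fix j
      have "(D j - column j E \<bullet> dh (E *v z)) * v $ j \<le> \<bar>D j - column j E \<bullet> dh (E *v z)\<bar> * \<bar>v $ j\<bar>"
        by (metis abs_ge_self abs_mult)
      also have "\<dots> \<le> M * \<delta> * norm v"
        using D(2) M_nonneg by (intro mult_mono component_le_norm_cart) (auto simp: \<delta>_def)
      finally show "(D j - column j E \<bullet> dh (E *v z)) * v $ j \<le> M * \<delta> * norm v" .
    qed
    also have "\<dots> = real CARD('n) * M * \<delta> * norm v" by simp
    also have "\<dots> \<le> real CARD('n) * M * \<delta> * (k * \<tau>)"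
      using vk M_nonneg by (intro mult_left_mono) (auto simp: \<delta>_def)
    also have "\<dots> = N * \<delta> * \<tau>" by (simp add: N_def mult_ac)
    finally have upper: "F z - F xs \<le> N * \<delta> * \<tau>" using \<open>F w = F xs\<close> by simp
    have "c * \<tau>\<^sup>2 \<le> F z - F xs" using quadratic_growth[OF z] by (simp add: \<tau>_def)
    with upper have "c * \<tau> * \<tau> \<le> N * \<delta> * \<tau>" by (simp add: power2_eq_square)
    then have "c * \<tau> \<le> N * \<delta>"
      using N by (cases "\<tau> = 0") (auto simp: \<tau>_def \<delta>_def)
    then have "\<tau> \<le> N * \<delta> / c" using c_pos by (simp add: field_simps)
    then have "N * \<delta> * \<tau> \<le> N * \<delta> * (N * \<delta> / c)"
      using N by (intro mult_left_mono) (auto simp: \<delta>_def)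
    with upper show ?thesis
      by (simp add: z_def \<delta>_def power2_eq_square mult_ac)
  qed
  then show ?thesis using c_pos by (intro exI[of _ R] exI[of _ "N\<^sup>2 / c"]) auto
qed

lemma converges: "\<exists>l\<in>feasible S. x \<longlonglongrightarrow> l \<and> E *v l = ts \<and> F l = F xs"
proof -
  obtain R B where RB: "0 \<le> B" "\<And>r. R \<le> r \<Longrightarrow> F (x (Suc r)) - F xs \<le> B * (norm (x (Suc r) - x r))\<^sup>2"
    using linear_rate by blast
  have "summable (\<lambda>r. norm (x (Suc r) - x r))" "(\<lambda>r. F (x r) - F xs) \<longlonglongrightarrow> 0"
    using summable_if_linear_rate[of "\<lambda>r. F (x r) - F xs" "\<lambda>r. norm (x (Suc r) - x r)" a B R]
      F_ge a_pos RB decrease by (auto simp: algebra_simps)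
  then have sums: "summable (\<lambda>r. x (Suc r) - x r)" and F0: "(\<lambda>r. F (x r)) \<longlonglongrightarrow> F xs"
    by (auto intro: summable_norm_cancel LIM_zero_cancel)
  from sums obtain s where "(\<lambda>n. \<Sum>r<n. x (Suc r) - x r) \<longlonglongrightarrow> s"
    unfolding summable_def sums_def by blast
  then have "(\<lambda>n. (x n - x 0) + x 0) \<longlonglongrightarrow> s + x 0"
    unfolding sum_lessThan_telescope by (intro tendsto_intros)
  then obtain l where l: "x \<longlonglongrightarrow> l" by auto
  have "0 \<le> l $ i" if "i \<in> - S" for i
    using feas that by (intro LIMSEQ_le_const[OF tendsto_vec_nth[OF l]]) (auto simp: feasible_def)
  then have feas_l: "l \<in> feasible S" by (simp add: feasible_def)
  have Ex: "(\<lambda>r. E *v x r) \<longlonglongrightarrow> E *v l"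
    using bounded_linear.tendsto[OF matrix_vector_mul_bounded_linear l] .
  have El: "E *v l = ts"
    using LIMSEQ_unique[OF LIMSEQ_Suc[OF Ex] images_tendsto] .
  have "(\<lambda>r. h (E *v x r)) \<longlonglongrightarrow> h (E *v l)"
    using inK xs_inK by (intro continuous_on_tendsto_compose[OF cont_h Ex]) (auto simp: El)
  moreover have "(\<lambda>r. pen S lam i (x r $ i)) \<longlonglongrightarrow> pen S lam i (l $ i)" for i
    unfolding pen_def by (auto intro!: tendsto_intros l)
  ultimately have "(\<lambda>r. F (x r)) \<longlonglongrightarrow> F l"
    unfolding obj_def by (intro tendsto_intros)
  then have "F l = F xs" using F0 by (rule LIMSEQ_unique)
  with feas_l l El show ?thesis by blast
qed

end

section \<open>Convergence of the cyclic coordinatewise descent algorithm\<close>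

theorem theorem2p1:
  fixes E :: "real ^ 'n ^ 'm"
    and S :: "'n set"
    and lam :: real
    and g :: "real ^ 'm \<Rightarrow> ereal"
    and \<sigma> :: "nat \<Rightarrow> 'n"
    and x :: "nat \<Rightarrow> real ^ 'n"
  assumes lam_pos: "0 < lam"
    and no_zero_column: "\<And>j. column j E \<noteq> 0"
    and g_proper: "\<And>t. g t \<noteq> -\<infinity>"
    and g_convex: "ext_convex g"
    and A1: "dom_interior g \<noteq> {}"
    and A2: "strictly_convex_on (dom_interior g) (\<lambda>t. real_of_ereal (g t))"
            "twice_cont_diff_on (dom_interior g) (\<lambda>t. real_of_ereal (g t))"
    and A3: "(\<forall>b \<in> frontier (dom_interior g). (g \<longlongrightarrow> \<infinity>) (at b within dom_interior g))
             \<or> (card S = CARD('n) \<and> (\<forall>t. 0 \<le> g t) \<and> dom_interior g = UNIV)"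
    and A4: "\<forall>t \<in> dom_interior g. positive_definite (hessian (\<lambda>t. real_of_ereal (g t)) t)"
    and A5: "minimizers (f1 g E S lam) (feasible S) \<noteq> {}"
    and enum: "bij_betw \<sigma> {1..CARD('n)} UNIV"
    and iterates: "ccd_iterates (f1 g E S lam) (feasible S) \<sigma> x"
  shows "\<exists>xstar \<in> feasible S.
           x \<longlonglongrightarrow> xstar \<and> (\<forall>z \<in> feasible S. f1 g E S lam xstar \<le> f1 g E S lam z)"
proof -
  define C where "C = dom_interior g"
  define h where "h = (\<lambda>t. real_of_ereal (g t))"
  define dh where "dh = gradient h"
  let ?f = "f1 g E S lam" and ?F = "obj h E S lam" and ?n = "CARD('n)"
  have openC: "open C" by (simp add: C_def dom_interior_def)
  note cvx = A2(1)[folded C_def h_def] and C2 = A2(2)[folded C_def h_def]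
    and pd = A4[folded C_def h_def]
  \<comment> \<open>the second alternative makes the frontier empty\<close>
  have blowup_g: "\<forall>b\<in>frontier C. (g \<longlongrightarrow> \<infinity>) (at b within C)"
    using A3 by (auto simp: C_def)
  have dom: "g t < \<infinity> \<longleftrightarrow> t \<in> C" for t
    unfolding C_def
    by (rule finite_iff_mem_dom_interior[OF g_convex A1 blowup_g[unfolded C_def]])
  have gh: "g t = ereal (h t)" if "t \<in> C" for t
    using g_proper[of t] dom[of t] that by (cases "g t") (auto simp: h_def)
  have blowup_h: "\<forall>b\<in>frontier C. filterlim h at_top (at b within C)"
  proof
    fix b assume "b \<in> frontier C"
    then have "(g \<longlongrightarrow> \<infinity>) (at b within C)" using blowup_g by blast
    moreover have "\<forall>\<^sub>F t in at b within C. g t = ereal (h t)"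
      using gh by (auto simp: eventually_at_filter)
    ultimately have "((\<lambda>t. ereal (h t)) \<longlongrightarrow> \<infinity>) (at b within C)"
      by (rule Lim_transform_eventually)
    then show "filterlim h at_top (at b within C)"
      by (simp add: tendsto_PInfty_eq_at_top)
  qed
  have f_eq: "?f z = ereal (?F z)" if "E *v z \<in> C" for z
    using gh[OF that] by (simp add: f1_def obj_def sum_pen)
  have f_fin: "E *v z \<in> C" if "?f z < \<infinity>" for z
    using that dom[of "E *v z"] by (auto simp: f1_def)
  have coord: "coord_opt S lam i (column i E \<bullet> dh (E *v y)) (y $ i)"
    if y: "y \<in> feasible S" "E *v y \<in> C"
      and min: "\<And>z. z \<in> feasible S \<Longrightarrow> \<forall>j. j \<noteq> i \<longrightarrow> z $ j = y $ j \<Longrightarrow> ?f y \<le> ?f z" for y i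
  proof (rule coord_opt_if_coordinate_minimizer[OF openC y(2) _ _ y(1)])
    show "GDERIV h (E *v y) :> dh (E *v y)"
      using C2 y(2) unfolding dh_def twice_cont_diff_on_def by (intro GDERIV_gradient) blast
    show "?F y \<le> ?F z" if "z \<in> feasible S" "\<forall>j. j \<noteq> i \<longrightarrow> z $ j = y $ j" "E *v z \<in> C" for z
      using min[OF that(1,2)] f_eq that(3) y(2) by simp
  qed (use lam_pos in simp)

  obtain xs where xs: "xs \<in> feasible S" "\<And>z. z \<in> feasible S \<Longrightarrow> ?f xs \<le> ?f z"
    using A5 unfolding minimizers_def by blast
  have x0: "x 0 \<in> feasible S" "?f (x 0) < \<infinity>" and sweep: "\<And>r. ccd_sweep ?f (feasible S) \<sigma> (x r) (x (Suc r))"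
    using iterates unfolding ccd_iterates_def by auto
  have xsC: "E *v xs \<in> C"
    using xs(2)[OF x0(1)] x0(2) by (intro f_fin) (rule le_less_trans)
  have xs_opt: "coord_opt S lam i (column i E \<bullet> dh (E *v xs)) (xs $ i)" for i
    using xs xsC by (intro coord) auto

  \<comment> \<open>\<open>K\<close> contains the images of all feasible points whose value is at most the initial one\<close>
  define K where "K = {t\<in>C. h t - gradient h (E *v xs) \<bullet> t \<le> ?F (x 0)}"
  have K: "K \<subseteq> C" "compact K" "convex K"
    unfolding K_def
    using compact_tilted_sublevel[OF openC cvx C2 pd blowup_h xsC] convex_tilted_sublevel[OF cvx]
    by auto
  have level: "E *v z \<in> K" if z: "z \<in> feasible S" "?f z \<le> ?f (x 0)" for z
  proof -
    have zC: "E *v z \<in> C" using z(2) x0(2) by (intro f_fin) (rule le_less_trans)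
    have "h (E *v z) - dh (E *v xs) \<bullet> (E *v z) \<le> ?F z"
      using xs_opt unfolding coord_opt_def by (intro obj_ge_tilted z(1)) blast
    also have "\<dots> \<le> ?F (x 0)" using z(2) f_eq[OF zC] f_eq[OF f_fin[OF x0(2)]] by simp
    finally show ?thesis using zC by (simp add: K_def dh_def)
  qed
  obtain c where c: "0 < c"
    "\<And>s t. s \<in> K \<Longrightarrow> t \<in> K \<Longrightarrow> h t + dh t \<bullet> (s - t) + c * (norm (s - t))\<^sup>2 \<le> h s"
    using strong_convexity_on_compact[OF C2 pd K] unfolding dh_def by blast
  obtain L where L: "0 \<le> L"
    "\<And>s t. s \<in> K \<Longrightarrow> t \<in> K \<Longrightarrow> norm (dh s - dh t) \<le> L * norm (s - t)"
    using gradient_lipschitz_on_compact[OF C2 K] unfolding dh_def by blast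
  obtain B where B: "0 \<le> B" "\<And>v. norm (E *v v) \<le> B * norm v"
    using bounded_linear.nonneg_bounded[OF matrix_vector_mul_bounded_linear[of E]]
    by (auto simp: mult.commute)
  have col_le: "norm (column j E) \<le> B" for j
    using B(2)[of "axis j 1"] by (simp add: matrix_vector_mult_basis)
  define b where "b = Min (range (\<lambda>j. norm (column j E)))"
  have b: "0 < b" "\<And>j. b \<le> norm (column j E)"
    using no_zero_column by (simp_all add: b_def)

  have swept: "x (Suc r) \<in> feasible S \<and> ?f (x (Suc r)) \<le> ?f (x 0) \<and>
      ?F (x (Suc r)) + c * b\<^sup>2 * (norm (x (Suc r) - x r))\<^sup>2 \<le> ?F (x r) \<and>
      (\<forall>j. \<exists>D. coord_opt S lam j D (x (Suc r) $ j) \<and>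
        \<bar>D - column j E \<bullet> dh (E *v x (Suc r))\<bar> \<le> B * L * B * norm (x (Suc r) - x r))"
    if xr: "x r \<in> feasible S" "?f (x r) \<le> ?f (x 0)" for r
  proof -
    from sweep[of r] obtain y where y: "y 0 = x r" "x (Suc r) = y ?n"
      "\<And>i. i \<in> {1..?n} \<Longrightarrow>
        y i \<in> minimizers ?f {z \<in> feasible S. \<forall>j. j \<noteq> \<sigma> i \<longrightarrow> z $ j = y (i - 1) $ j}"
      unfolding ccd_sweep_def by blast
    have ymin: "y i \<in> feasible S" "\<And>j. j \<noteq> \<sigma> i \<Longrightarrow> y i $ j = y (i - 1) $ j"
      "\<And>z. z \<in> feasible S \<Longrightarrow> \<forall>j. j \<noteq> \<sigma> i \<longrightarrow> z $ j = y (i - 1) $ j \<Longrightarrow> ?f (y i) \<le> ?f z"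
      if "i \<in> {1..?n}" for i
      using y(3)[OF that] unfolding minimizers_def by auto
    have ylev: "i \<le> ?n \<longrightarrow> y i \<in> feasible S \<and> ?f (y i) \<le> ?f (x 0)" for i
    proof (induction i)
      case 0
      then show ?case using xr y(1) by simp
    next
      case (Suc i)
      show ?case
      proof
        assume i: "Suc i \<le> ?n"
        then have "?f (y (Suc i)) \<le> ?f (y i)" using Suc by (intro ymin(3)) auto
        with i Suc ymin(1)[of "Suc i"] show "y (Suc i) \<in> feasible S \<and> ?f (y (Suc i)) \<le> ?f (x 0)"
          by (auto intro: order_trans)
      qed
    qed
    have inK: "E *v y i \<in> K" if "i \<le> ?n" for i
      using level ylev that by blast
    have yopt: "coord_opt S lam (\<sigma> i) (column (\<sigma> i) E \<bullet> dh (E *v y i)) (y i $ \<sigma> i)"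
      if i: "i \<in> {1..?n}" for i
      using ymin[OF i] inK[of i] K(1) i by (intro coord) auto
    note est = sweep_estimates[where S = S and lam = lam and h = h and dh = dh and y = y and K = K,
        OF enum _ inK ymin(2) yopt c(2) L(2) _ L(1) _ B(1) b(2) col_le B(2)]
    have fy: "\<And>i. i \<le> ?n \<Longrightarrow> y i \<in> feasible S" using ylev by blast
    show ?thesis
      using ylev[of ?n] est(1)[OF fy] est(2)[OF fy] c(1) b(1)
      unfolding y(2) y(1)[symmetric] by simp
  qed
  have lev: "x r \<in> feasible S \<and> ?f (x r) \<le> ?f (x 0)" for r
    by (induction r) (use x0(1) swept in auto)

  interpret coordinate_descent E S lam h dh K c "c * b\<^sup>2" "B * L * B" x xs
  proof
    show "continuous_on K h"
      using C2 K(1) unfolding twice_cont_diff_on_def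
      by (meson differentiable_imp_continuous_within continuous_at_imp_continuous_on subsetD)
    show "continuous_on K dh"
      using C2 K(1) unfolding twice_cont_diff_on_def dh_def
      by (meson differentiable_imp_continuous_within continuous_at_imp_continuous_on subsetD)
    show "E *v xs \<in> K" using level[OF xs(1) xs(2)[OF x0(1)]] .
    show "0 < c * b\<^sup>2" "0 \<le> B * L * B" using c(1) b(1) B(1) L(1) by auto
    show "E *v x r \<in> K" for r using level lev by blast
    fix r
    show "?F (x (Suc r)) + c * b\<^sup>2 * (norm (x (Suc r) - x r))\<^sup>2 \<le> ?F (x r)"
      using swept lev by blast
    show "\<exists>D. coord_opt S lam j D (x (Suc r) $ j) \<and>
        \<bar>D - column j E \<bullet> dh (E *v x (Suc r))\<bar> \<le> B * L * B * norm (x (Suc r) - x r)" for j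
      using swept lev by blast
  qed (use K c xs(1) xs_opt lev in auto)
  obtain l where l: "l \<in> feasible S" "x \<longlonglongrightarrow> l" "E *v l = E *v xs" "?F l = ?F xs"
    using converges by blast
  have "?f l = ?f xs" using f_eq[OF xsC] f_eq[of l] l(3,4) xsC by simp
  with l(1,2) xs(2) show ?thesis by auto
qed

end
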